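(* Let $\mathtt\Delta_0=U\Sigma V^\top$ and $\bar{\mathtt\Delta}_0=\bar U\bar\Sigma\bar V^\top$ be the singular value decompositions of $\mathtt\Delta_0$ and $\bar{\mathtt\Delta}_0$ respectively. Then $$P=U(\kappa^2+\Sigma)V^\top,\qquad \bar P=\bar U(\kappa^2+\bar\Sigma)\bar V^\top,$$ and $$C^{-1}(\alpha,\kappa)=V(\kappa^2+\Sigma)^{\alpha}V^\top,\qquad \bar C^{-1}(\alpha,\kappa)=\bar V(\kappa^2+\bar\Sigma)^{\alpha}\bar V^\top.$$ Furthermore, if $\Pi_k,\bar\Pi_k$ are orthogonal projections onto any $k$-dimensional eigenspace of $C(\alpha,\kappa)$, $\bar C(\alpha,\kappa)$ respectively, then $\Pi_k,\bar\Pi_k$ are invariant to $\alpha,\kappa$.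
   Context: $M$ is a finite simplicial triangulation of a complete boundaryless Riemannian $m$-manifold, well-centered (every constituent simplex strictly contains its circumcenter) and shape-regular (ratio of circumradius to inradius bounded over all constituent simplices), and $M'$ is its circumcentric dual polytopal complex: each $k$-simplex $\sigma$ has an orthogonal dual $(m-k)$-cell $\ast\sigma$. $n,n'$ are the numbers of vertices of $M,M'$. $\mathtt d,\bar{\mathtt d}$ are the coboundary operators on cochains of $M,M'$. The discrete Hodge star on $k$-cochains is the diagonal matrix with entries (volume of dual cell)/(volume of cell), denoted $\star_k$ on $M$ and $\bar\star_k$ on $M'$. The DEC Hodge-Laplacians on $0$-cochains are $\mathtt\Delta_0=\bar\star_m\bar{\mathtt d}_{m-1}\star_1\mathtt d_0$ on $M$ and $\bar{\mathtt\Delta}_0=\star_m\mathtt d_{m-1}\bar\star_1\bar{\mathtt d}_0$ on $M'$. For $\alpha\in\mathbb{N}$ and $\kappa\in\mathbb{R}$ (with $\kappa^2+\mathbf{\Delta}_0$ strictly positive, $\mathbf{\Delta}_0$ the Laplace–Beltrami operator), $P=\kappa^2I_n+\mathtt\Delta_0$, $\bar P=\kappa^2I_{n'}+\bar{\mathtt\Delta}_0$, and $C(\alpha,\kappa)=\left((P^{\lfloor\alpha/2\rfloor})^\top P^{\lceil\alpha/2\rceil}\right)^{-1}$, $\bar C(\alpha,\kappa)=\left((\bar P^{\lfloor\alpha/2\rfloor})^\top\bar P^{\lceil\alpha/2\rceil}\right)^{-1}$ are the discrete covariance matrices of, respectively, the nodal values and the $m$-simplexwise means of the solution of $(\kappa^2+\mathbf{\Delta}_0)^{\alpha/2}u=\mathcal{W}$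 ($\mathcal{W}$ Gaussian white noise).
   Formalization: As the claim fails for non-symmetric Laplacians, transposes, SVDs and projections are taken in the Hodge-star inner product, or literally if the Laplacian is symmetric; the formula for P assumes equal left/right null singular vectors; invariance of the projections assumes α ≥ 1. *)

theory Defs
  imports "HOL-Analysis.Analysis" "Jordan_Normal_Form.Char_Poly" "Jordan_Normal_Form.Matrix_Kernel"
begin

subsection \<open>Piecewise flat triangulations\<close>

text \<open>
  A mesh is an abstract simplicial complex; every simplex carries a chart realizing it as a
  nondegenerate Euclidean simplex, and the charts agree on edge lengths, so the metric is intrinsic
  and no global embedding is needed. \<^term>\<open>numbering M k i\<close> is the \<open>i\<close>-th \<open>k\<close>-simplex (it fixes the
  coordinates of cochains). \<^term>\<open>orientation M s\<close> is \<open>1\<close> or \<open>- 1\<close>, comparing the chosen orientation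
  of \<open>s\<close> with the one given by the vertex order.
\<close>

record ('v, 'a) mesh =
  mdim :: nat
  simplices :: "'v set set"
  chart :: "'v set \<Rightarrow> 'v \<Rightarrow> 'a"
  numbering :: "nat \<Rightarrow> nat \<Rightarrow> 'v set"
  orientation :: "'v set \<Rightarrow> real"

definition ksimplices :: "('v, 'a, 'z) mesh_scheme \<Rightarrow> nat \<Rightarrow> 'v set set" where
  "ksimplices M k = {s \<in> simplices M. card s = Suc k}"

definition ncells :: "('v, 'a, 'z) mesh_scheme \<Rightarrow> nat \<Rightarrow> nat" where
  "ncells M k = card (ksimplices M k)"

text \<open>The underlying space, in barycentric coordinates.\<close>

definition polyhedron :: "('v, 'a, 'z) mesh_scheme \<Rightarrow> ('v \<Rightarrow> real) set" where
  "polyhedron M = {f. (\<forall>v. 0 \<le> f v) \<and> {v. f v \<noteq> 0} \<in> simplices M \<and> (\<Sum>v\<in>{v. f v \<noteq> 0}. f v) = 1}"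

text \<open>Hausdorffness and second countability are automatic for the polyhedron of a finite complex;
  so is compactness, hence completeness.\<close>

definition boundaryless_manifold :: "('v, 'a, 'z) mesh_scheme \<Rightarrow> bool" where
  "boundaryless_manifold M \<longleftrightarrow>
     (\<forall>p \<in> polyhedron M. \<exists>U. openin (top_of_set (polyhedron M)) U \<and> p \<in> U \<and>
        top_of_set U homeomorphic_space Euclidean_space (mdim M))"

definition triangulation :: "('v::linorder, 'a::euclidean_space, 'z) mesh_scheme \<Rightarrow> bool" where
  "triangulation M \<longleftrightarrow>
     1 \<le> mdim M \<and>
     finite (simplices M) \<and> simplices M \<noteq> {} \<and>
     (\<forall>s \<in> simplices M. finite s \<and> s \<noteq> {} \<and> (\<forall>t. t \<subseteq> s \<and> t \<noteq> {} \<longrightarrow> t \<in> simplices M)) \<and>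
     (\<forall>s \<in> simplices M. \<exists>t \<in> ksimplices M (mdim M). s \<subseteq> t) \<and>
     (\<forall>s \<in> simplices M. card s \<le> Suc (mdim M)) \<and>
     boundaryless_manifold M \<and>
     (\<forall>s \<in> simplices M. inj_on (chart M s) s \<and> \<not> affine_dependent (chart M s ` s)) \<and>
     (\<forall>s \<in> simplices M. \<forall>t \<in> simplices M. t \<subseteq> s \<longrightarrow>
        (\<forall>v \<in> t. \<forall>w \<in> t. dist (chart M t v) (chart M t w) = dist (chart M s v) (chart M s w))) \<and>
     (\<forall>k. bij_betw (numbering M k) {..<ncells M k} (ksimplices M k)) \<and>
     (\<forall>s \<in> simplices M. orientation M s \<in> {1, - 1}) \<and>
     (\<forall>s \<in> ksimplices M 0. orientation M s = 1)"


subsection \<open>Circumcenters, well-centeredness, shape regularity\<close>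

definition circumcenter :: "'a::euclidean_space set \<Rightarrow> 'a" where
  "circumcenter S = (THE c. c \<in> affine hull S \<and> (\<exists>r. \<forall>p \<in> S. dist c p = r))"

definition circumradius :: "'a::euclidean_space set \<Rightarrow> real" where
  "circumradius S = (THE r. \<forall>p \<in> S. dist (circumcenter S) p = r)"

definition inradius :: "'a::euclidean_space set \<Rightarrow> real" where
  "inradius S =
     Sup {r. 0 \<le> r \<and> (\<exists>z \<in> affine hull S. cball z r \<inter> affine hull S \<subseteq> convex hull S)}"

text \<open>Every simplex is tested in the chart of each simplex having it as a face; as the charts are
  isometric on common faces, this is the same as testing it in its own chart.\<close>

definition well_centered :: "('v, 'a::euclidean_space, 'z) mesh_scheme \<Rightarrow> bool" where
  "well_centered M \<longleftrightarrow>
     (\<forall>s \<in> simplices M. \<forall>t \<in> simplices M. t \<subseteq> s \<longrightarrow>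
        circumcenter (chart M s ` t) \<in> rel_interior (convex hull (chart M s ` t)))"

text \<open>Vertices are left out: they have no inradius.\<close>

definition shape_regular :: "('v, 'a::euclidean_space, 'z) mesh_scheme \<Rightarrow> bool" where
  "shape_regular M \<longleftrightarrow>
     (\<exists>B. \<forall>s \<in> simplices M. 2 \<le> card s \<longrightarrow>
        circumradius (chart M s ` s) / inradius (chart M s ` s) \<le> B)"


subsection \<open>Volumes of simplices and of circumcentric dual cells\<close>

text \<open>The \<open>k\<close>-volume of the simplex with the given \<open>k + 1\<close> vertices, as height times base over \<open>k\<close>;
  a point has volume \<open>1\<close>.\<close>

fun simplex_volume :: "'a::euclidean_space list \<Rightarrow> real" where
  "simplex_volume [] = 1"
| "simplex_volume [p] = 1"
| "simplex_volume (p # q # ps) =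
     infdist p (affine hull set (q # ps)) * simplex_volume (q # ps) / real (length (q # ps))"

definition volume :: "('v::linorder, 'a::euclidean_space, 'z) mesh_scheme \<Rightarrow> 'v set \<Rightarrow> real" where
  "volume M s = simplex_volume (map (chart M s) (sorted_list_of_set s))"

text \<open>Complete flags from a top-dimensional simplex (the head of the list) down to \<open>s\<close> (its last element).\<close>

definition flags :: "('v, 'a, 'z) mesh_scheme \<Rightarrow> 'v set \<Rightarrow> 'v set list set" where
  "flags M s = {F. F \<noteq> [] \<and> hd F \<in> ksimplices M (mdim M) \<and> last F = s \<and> set F \<subseteq> simplices M \<and>
     successively (\<lambda>u t. t \<subset> u \<and> card u = Suc (card t)) F}"

text \<open>The dual cell of \<open>s\<close> is the union, over these flags, of the simplices spanned by the
  circumcenters of the flag, which lie in the chart of its head. On a well-centered mesh these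
  do not overlap, so their volumes add up without signs.\<close>

definition dual_volume :: "('v, 'a::euclidean_space, 'z) mesh_scheme \<Rightarrow> 'v set \<Rightarrow> real" where
  "dual_volume M s =
     (\<Sum>F \<in> flags M s. simplex_volume (map (\<lambda>t. circumcenter (chart M (hd F) ` t)) F))"


subsection \<open>Coboundaries, Hodge stars and Laplacians\<close>

definition incidence :: "('v::linorder, 'a, 'z) mesh_scheme \<Rightarrow> 'v set \<Rightarrow> 'v set \<Rightarrow> real" where
  "incidence M t s =
     (if s \<subset> t \<and> card t = Suc (card s)
      then orientation M t * orientation M s * (- 1) ^ card {w \<in> t. w < the_elem (t - s)}
      else 0)"

definition coboundary :: "('v::linorder, 'a, 'z) mesh_scheme \<Rightarrow> nat \<Rightarrow> real mat" where
  "coboundary M k =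
     Matrix.mat (ncells M (Suc k)) (ncells M k) (\<lambda>(i, j). incidence M (numbering M (Suc k) i) (numbering M k j))"

text \<open>The \<open>k\<close>-cells of the dual complex are the duals of the \<open>(m - k)\<close>-simplices and are numbered
  like these. Dual cells are oriented so that the incidence of \<open>*s\<close> with its face \<open>*t\<close>
  (for \<open>s\<close> a face of \<open>t\<close>) is that of \<open>t\<close> with \<open>s\<close>. If the \<open>m\<close>-simplices are
  coherently oriented, this is the ordinary coboundary of the dual complex with positively oriented
  dual vertices, the dual edges being directed across their \<open>(m - 1)\<close>-simplices; coherence is not needed
  below and so not imposed. These signs make both Laplacians nonnegative.\<close>

definition dual_coboundary :: "('v::linorder, 'a, 'z) mesh_scheme \<Rightarrow> nat \<Rightarrow> real mat" where
  "dual_coboundary M k =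
     Matrix.mat (ncells M (mdim M - Suc k)) (ncells M (mdim M - k))
       (\<lambda>(i, j). incidence M (numbering M (mdim M - k) j) (numbering M (mdim M - Suc k) i))"

definition star :: "('v::linorder, 'a::euclidean_space, 'z) mesh_scheme \<Rightarrow> nat \<Rightarrow> real mat" where
  "star M k = mat_diag (ncells M k) (\<lambda>i. dual_volume M (numbering M k i) / volume M (numbering M k i))"

definition dual_star :: "('v::linorder, 'a::euclidean_space, 'z) mesh_scheme \<Rightarrow> nat \<Rightarrow> real mat" where
  "dual_star M k = mat_diag (ncells M (mdim M - k))
     (\<lambda>i. volume M (numbering M (mdim M - k) i) / dual_volume M (numbering M (mdim M - k) i))"

definition laplacian :: "('v::linorder, 'a::euclidean_space, 'z) mesh_scheme \<Rightarrow> real mat" where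
  "laplacian M =
     dual_star M (mdim M) * dual_coboundary M (mdim M - 1) * star M 1 * coboundary M 0"

definition dual_laplacian :: "('v::linorder, 'a::euclidean_space, 'z) mesh_scheme \<Rightarrow> real mat" where
  "dual_laplacian M =
     star M (mdim M) * coboundary M (mdim M - 1) * dual_star M 1 * dual_coboundary M 0"


subsection \<open>Linear algebra relative to an inner product\<close>

definition minv :: "real mat \<Rightarrow> real mat" where
  "minv A = the (mat_inverse A)"

text \<open>\<open>adj G A\<close> is the adjoint of \<open>A\<close> for the inner product with Gram matrix \<open>G\<close>, i.e. the
  transpose when \<open>G\<close> is the identity (or a scalar multiple of it). The inner products
  of \<open>0\<close>-cochains given by the Hodge stars have Gram matrices \<^term>\<open>star M 0\<close> and
  \<^term>\<open>dual_star M 0\<close>.\<close>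

definition adj :: "real mat \<Rightarrow> real mat \<Rightarrow> real mat" where
  "adj G A = minv G * transpose_mat A * G"

lemma adj_one:
  assumes "A \<in> carrier_mat n n"
  shows "adj (1\<^sub>m n) A = transpose_mat A"
proof -
  have one: "(1\<^sub>m n :: real mat) \<in> carrier_mat n n" by simp
  have "1\<^sub>m n \<in> Units (ring_mat TYPE(real) n ())"
    unfolding Units_def ring_mat_def by (auto intro!: bexI[of _ "1\<^sub>m n"])
  then obtain B where B: "mat_inverse (1\<^sub>m n :: real mat) = Some B"
    using mat_inverse(1)[OF one, of "()"] by (cases "mat_inverse (1\<^sub>m n :: real mat)") auto
  then have "1\<^sub>m n * B = 1\<^sub>m n" "B \<in> carrier_mat n n" using mat_inverse(2)[OF one B] by auto
  then have "B = 1\<^sub>m n" by simp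
  then show ?thesis using assms B by (simp add: adj_def minv_def)
qed

definition is_svd :: "real mat \<Rightarrow> real mat \<Rightarrow> real mat \<Rightarrow> real mat \<Rightarrow> real mat \<Rightarrow> bool" where
  "is_svd G A U S V \<longleftrightarrow>
     (let n = dim_row A in
      U \<in> carrier_mat n n \<and> S \<in> carrier_mat n n \<and> V \<in> carrier_mat n n \<and>
      adj G U * U = 1\<^sub>m n \<and> adj G V * V = 1\<^sub>m n \<and>
      diagonal_mat S \<and> (\<forall>i < n. 0 \<le> S $$ (i, i)) \<and>
      A = U * S * adj G V)"

text \<open>The equations of an SVD leave the singular vectors of the singular value \<open>0\<close> unrelated
  on the left and on the right (even their signs may differ).\<close>

definition null_vectors_paired :: "real mat \<Rightarrow> real mat \<Rightarrow> real mat \<Rightarrow> bool" where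
  "null_vectors_paired U S V \<longleftrightarrow> (\<forall>i < dim_row S. S $$ (i, i) = 0 \<longrightarrow> col U i = col V i)"

definition shifted :: "real \<Rightarrow> real mat \<Rightarrow> real mat" where
  "shifted \<kappa> A = \<kappa>\<^sup>2 \<cdot>\<^sub>m 1\<^sub>m (dim_row A) + A"

definition precision :: "real mat \<Rightarrow> real mat \<Rightarrow> nat \<Rightarrow> real \<Rightarrow> real mat" where
  "precision G L \<alpha> \<kappa> =
     adj G (shifted \<kappa> L ^\<^sub>m (\<alpha> div 2)) * shifted \<kappa> L ^\<^sub>m ((\<alpha> + 1) div 2)"

definition covariance :: "real mat \<Rightarrow> real mat \<Rightarrow> nat \<Rightarrow> real \<Rightarrow> real mat" where
  "covariance G L \<alpha> \<kappa> = minv (precision G L \<alpha> \<kappa>)"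

definition is_orthogonal_projection :: "real mat \<Rightarrow> real vec set \<Rightarrow> real mat \<Rightarrow> bool" where
  "is_orthogonal_projection G W Q \<longleftrightarrow>
     Q \<in> carrier_mat (dim_row G) (dim_row G) \<and> Q * Q = Q \<and> adj G Q = Q \<and>
     (\<lambda>v. Q *\<^sub>v v) ` carrier_vec (dim_row G) = W"

text \<open>Orthogonal projections onto the \<open>k\<close>-dimensional eigenspaces of \<open>C\<close>.\<close>

definition eigenprojections :: "real mat \<Rightarrow> real mat \<Rightarrow> nat \<Rightarrow> real mat set" where
  "eigenprojections G C k =
     {Q. \<exists>\<mu>. eigenvalue C \<mu> \<and> kernel_dim (char_matrix C \<mu>) = k \<and>
        is_orthogonal_projection G (mat_kernel (char_matrix C \<mu>)) Q}"

end

(*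
  Up to the diagonal weight h, both Laplacians have the form h^-1 D^T c D with D an incidence matrix
  and h > 0, c >= 0. Positivity of the volumes is where well-centeredness enters: the circumcenter of
  a simplex lies off the affine hull of each proper face, so every simplex spanned by the
  circumcenters of a flag is nondegenerate. An operator h^-1 D^T c D is self-adjoint with nonnegative
  spectrum, hence (real spectral theorem, conjugated by the square root of the Gram matrix)
  diagonal in some orthonormal basis. In any SVD L = U S V*, squaring gives L^2 = V S^2 V*; a
  nonnegative square root is unique, so L = V S V*, and the precision is the function
  (kappa^2 + s)^alpha of L. Since (kappa^2 + s)^-alpha is injective in s >= 0, the covariance has the
  same eigenspaces as L.
*)

theory Submission
  imports Defs "Jordan_Normal_Form.Spectral_Radius"
begin

text \<open>The matrix of a DEC Laplacian is in general not symmetric, and with plain transposes the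
  formula for \<open>P\<close> then fails: for nonzero \<kappa>, subtracting the decomposition of
  the Laplacian from it leaves \<open>U * transpose_mat V = 1\<close>, so \<open>U = V\<close> and
  the Laplacian is symmetric. Hence transposes are read as adjoints for the Hodge-star inner
  product, in which self-adjointness is automatic; the ordinary transpose remains as the case of a
  symmetric matrix. For the same reason null vectors have to be paired: on the kernel an SVD may
  well have \<open>U = - V\<close>. Serving both inner products shapes the central theorem, which
  carries two weights: \<open>g\<close> defines adjoints, and \<open>h\<close> certifies that
  eigenvalues are nonnegative. The energy of the Laplacian is visibly a sum of squares in the
  Hodge-star weight, and the sign of an eigenvalue can be read off in any positive weight. A nonzero
  \<kappa> keeps \<open>P\<close> invertible on the constant cochains, which the primal Laplacian
  annihilates.\<close>

unbundle no vec_syntax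
no_notation inner (infix "\<bullet>" 70)

section \<open>Orthogonal diagonalization of real symmetric matrices\<close>

lemma symmetric_bilinear_swap:
  fixes A :: "real mat"
  assumes A: "A \<in> carrier_mat n n" "transpose_mat A = A" and x: "x \<in> carrier_vec n" and y: "y \<in> carrier_vec n"
  shows "(A *\<^sub>v x) \<bullet> y = x \<bullet> (A *\<^sub>v y)"
  using transpose_vec_mult_scalar[OF A(1) x y] A(2) A(1) x y
  by (metis comm_scalar_prod mult_mat_vec_carrier)

lemma scalar_prod_self_zero_iff:
  fixes v :: "real vec"
  shows "v \<bullet> v = 0 \<longleftrightarrow> v = 0\<^sub>v (dim_vec v)"
proof
  assume "v \<bullet> v = 0"
  then have "\<forall>i\<in>{0..<dim_vec v}. v $ i * v $ i = 0"
    unfolding scalar_prod_def by (subst (asm) sum_nonneg_eq_0_iff) auto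
  then show "v = 0\<^sub>v (dim_vec v)" by (intro eq_vecI) auto
next
  assume "v = 0\<^sub>v (dim_vec v)"
  then show "v \<bullet> v = 0" by (metis carrier_vec_dim_vec scalar_prod_left_zero)
qed

text \<open>An eigenvector exists over the complex numbers. Symmetry makes its eigenvalue real, and
  then its real and imaginary parts, not both zero, each satisfy the real eigenvalue
  equation.\<close>

lemma symmetric_real_eigenvector:
  fixes A :: "real mat"
  assumes A: "A \<in> carrier_mat n n" and sym: "transpose_mat A = A" and n: "0 < n"
  shows "\<exists>v a. v \<in> carrier_vec n \<and> v \<noteq> 0\<^sub>v n \<and> A *\<^sub>v v = a \<cdot>\<^sub>v v"
proof -
  define B where "B = map_mat complex_of_real A"
  have B: "B \<in> carrier_mat n n" using A by (simp add: B_def)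
  from spectrum_non_empty[OF B n] obtain e where "eigenvalue B e" by (auto simp: spectrum_def)
  then obtain z where z: "z \<in> carrier_vec n" "z \<noteq> 0\<^sub>v n" "B *\<^sub>v z = e \<cdot>\<^sub>v z"
    using B by (auto simp: eigenvalue_def eigenvector_def)
  define x y where "x = map_vec Re z" and "y = map_vec Im z"
  have x: "x \<in> carrier_vec n" and y: "y \<in> carrier_vec n" using z by (auto simp: x_def y_def)
  have "A *\<^sub>v x = map_vec Re (B *\<^sub>v z)" "A *\<^sub>v y = map_vec Im (B *\<^sub>v z)"
    using A z(1) by (auto intro!: eq_vecI simp: B_def x_def y_def scalar_prod_def Re_sum Im_sum)
  then have Ax: "A *\<^sub>v x = Re e \<cdot>\<^sub>v x - Im e \<cdot>\<^sub>v y" and Ay: "A *\<^sub>v y = Re e \<cdot>\<^sub>v y + Im e \<cdot>\<^sub>v x"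
    unfolding z(3) using z(1) by (auto intro!: eq_vecI simp: x_def y_def)
  \<comment> \<open>The two sides of the symmetry relation between \<open>x\<close> and
    \<open>y\<close> share the \<open>Re e\<close> term; what remains is \<open>Im e\<close> times
    the squared length of \<open>z\<close>.\<close>
  have "(A *\<^sub>v x) \<bullet> y = Re e * (x \<bullet> y) - Im e * (y \<bullet> y)"
    unfolding Ax using x y by (simp add: minus_scalar_prod_distrib[of _ n])
  moreover have "x \<bullet> (A *\<^sub>v y) = Re e * (x \<bullet> y) + Im e * (x \<bullet> x)"
    unfolding Ay using x y by (simp add: scalar_prod_add_distrib[of _ n])
  ultimately have "Im e * (x \<bullet> x + y \<bullet> y) = 0"
    using symmetric_bilinear_swap[OF A sym x y] by (simp add: algebra_simps)
  moreover have pos: "0 \<le> x \<bullet> x" "0 \<le> y \<bullet> y" by (auto simp: scalar_prod_def intro!: sum_nonneg)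
  moreover have "x \<noteq> 0\<^sub>v n \<or> y \<noteq> 0\<^sub>v n"
  proof (rule ccontr)
    assume "\<not> ?thesis"
    then have "\<And>i. i < n \<Longrightarrow> Re (z $ i) = 0 \<and> Im (z $ i) = 0"
      using z(1) unfolding x_def y_def by (metis carrier_vecD index_map_vec(1) index_zero_vec(1))
    then have "z = 0\<^sub>v n" using z(1) by (intro eq_vecI) (auto simp: complex_eq_iff)
    then show False using z(2) by simp
  qed
  ultimately have xy: "x \<bullet> x + y \<bullet> y \<noteq> 0"
    using x y scalar_prod_self_zero_iff by (metis add_nonneg_eq_0_iff carrier_vecD)
  then have "Im e = 0" using \<open>Im e * (x \<bullet> x + y \<bullet> y) = 0\<close> by simp
  then have "A *\<^sub>v x = Re e \<cdot>\<^sub>v x" "A *\<^sub>v y = Re e \<cdot>\<^sub>v y" using Ax Ay x y by auto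
  then show ?thesis using x y \<open>x \<noteq> 0\<^sub>v n \<or> y \<noteq> 0\<^sub>v n\<close> by blast
qed

lemma orthogonal_with_first_column:
  fixes v :: "real vec"
  assumes v: "v \<in> carrier_vec n" "v \<bullet> v = 1" and n: "0 < n"
  shows "\<exists>H. H \<in> carrier_mat n n \<and> transpose_mat H = H \<and> H * H = 1\<^sub>m n \<and> col H 0 = v"
proof -
  \<comment> \<open>The Householder reflection exchanging \<open>v\<close> and the first unit vector; if they are equal,
    then \<open>c = 2 / 0 = 0\<close> and it is the identity.\<close>
  define w where "w = unit_vec n 0 - v"
  define c where "c = 2 / (w \<bullet> w)"
  define H where "H = Matrix.mat n n (\<lambda>(i, j). (if i = j then 1 else 0) - c * w $ i * w $ j)"
  have w: "w \<in> carrier_vec n" using v by (simp add: w_def)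
  have sw: "(\<Sum>k<n. w $ k * w $ k) = w \<bullet> w" using w by (simp add: scalar_prod_def atLeast0LessThan)
  have cw: "c * c * (w \<bullet> w) = 2 * c" by (simp add: c_def)
  have H: "H \<in> carrier_mat n n" by (simp add: H_def)
  have "H * H = 1\<^sub>m n"
  proof (rule eq_matI)
    fix i j assume "i < dim_row (1\<^sub>m n)" "j < dim_col (1\<^sub>m n)"
    then have ij: "i < n" "j < n" by auto
    have "(H * H) $$ (i, j) = (\<Sum>k<n. ((if i = k then 1 else 0) - c * w $ i * w $ k) *
      ((if k = j then 1 else 0) - c * w $ k * w $ j))"
      using ij H by (simp add: scalar_prod_def H_def atLeast0LessThan)
    also have "\<dots> = (\<Sum>k<n. (if k = i then (if i = j then 1 else 0) - c * w $ i * w $ j else 0) -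
       (if k = j then c * w $ i * w $ j else 0) + c * c * w $ i * w $ j * (w $ k * w $ k))"
      by (intro sum.cong) (auto simp: algebra_simps)
    also have "\<dots> = (if i = j then 1 else 0) - 2 * c * w $ i * w $ j + c * c * (w \<bullet> w) * w $ i * w $ j"
      using ij by (simp add: sum.distrib sum_subtractf flip: sum_distrib_left) (simp add: sw algebra_simps)
    also have "\<dots> = 1\<^sub>m n $$ (i, j)" unfolding cw using ij by simp
    finally show "(H * H) $$ (i, j) = 1\<^sub>m n $$ (i, j)" .
  qed (auto simp: H_def)
  moreover have "col H 0 = v"
  proof -
    have "w \<bullet> w = unit_vec n 0 \<bullet> unit_vec n 0 - 2 * (unit_vec n 0 \<bullet> v) + v \<bullet> v"
      using v n by (simp add: w_def minus_scalar_prod_distrib[of _ n] scalar_prod_minus_distrib[of _ n]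
        comm_scalar_prod[of v n "unit_vec n 0"])
    \<comment> \<open>Because both vectors have length one, \<open>w \<bullet> w\<close> is twice
      \<open>w $ 0\<close>. So \<open>c * w $ 0 = 1\<close> unless \<open>w = 0\<close>, and the
      first column of \<open>H\<close> is the first unit vector minus \<open>w\<close>, which is
      \<open>v\<close>.\<close>
    then have ww: "w \<bullet> w = 2 * (1 - v $ 0)" using v n by simp
    have w0: "w $ 0 = 1 - v $ 0" using v n by (simp add: w_def)
    have "c * w $ 0 * w $ i = w $ i" if "i < n" for i
    proof (cases "w \<bullet> w = 0")
      case True
      then have "w = 0\<^sub>v n" using w scalar_prod_self_zero_iff by (metis carrier_vecD)
      then show ?thesis using that by simp
    next
      case False
      then show ?thesis using ww w0 by (simp add: c_def)
    qed
    then show ?thesis using v n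
      by (intro eq_vecI) (auto simp: H_def w_def algebra_simps)
  qed
  moreover have "transpose_mat H = H" by (rule eq_matI) (auto simp: H_def)
  ultimately show ?thesis using H by blast
qed

lemma block_diagonal_mult:
  fixes A :: "'b::ring_1 mat"
  assumes "A \<in> carrier_mat m m" "B \<in> carrier_mat n n" "C \<in> carrier_mat m m" "D \<in> carrier_mat n n"
  shows "four_block_mat A (0\<^sub>m m n) (0\<^sub>m n m) B * four_block_mat C (0\<^sub>m m n) (0\<^sub>m n m) D =
    four_block_mat (A * C) (0\<^sub>m m n) (0\<^sub>m n m) (B * D)"
  using assms by (subst mult_four_block_mat[of _ m m _ n _ n _ _ m _ n]) auto

text \<open>Deflation: conjugating by the reflection \<open>H\<close> moves an eigenvector to the
  first coordinate axis. The first column of \<open>B\<close> is then zero below the corner, by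
  symmetry so is the first row beyond it, and the induction hypothesis diagonalizes the remaining
  block. \<open>H\<close> is its own transpose and inverse, so conjugation preserves symmetry and is
  undone by repeating it.\<close>

theorem symmetric_spectral:
  fixes A :: "real mat"
  assumes "A \<in> carrier_mat n n" "transpose_mat A = A"
  shows "\<exists>W f. W \<in> carrier_mat n n \<and> transpose_mat W * W = 1\<^sub>m n \<and> A = W * mat_diag n f * transpose_mat W"
  using assms
proof (induction n arbitrary: A)
  case 0
  then show ?case by (intro exI[of _ "1\<^sub>m 0"]) (auto intro!: eq_matI)
next
  case (Suc n)
  note A = Suc.prems(1) and sym = Suc.prems(2)
  obtain v0 a where v0: "v0 \<in> carrier_vec (Suc n)" "v0 \<noteq> 0\<^sub>v (Suc n)" "A *\<^sub>v v0 = a \<cdot>\<^sub>v v0"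
    using symmetric_real_eigenvector[OF A sym] by auto
  define v where "v = (1 / sqrt (v0 \<bullet> v0)) \<cdot>\<^sub>v v0"
  have v: "v \<in> carrier_vec (Suc n)" using v0 by (simp add: v_def)
  have "0 < v0 \<bullet> v0"
  proof -
    have "v0 \<bullet> v0 \<noteq> 0" using v0 scalar_prod_self_zero_iff[of v0] by auto
    moreover have "0 \<le> v0 \<bullet> v0" by (auto simp: scalar_prod_def intro!: sum_nonneg)
    ultimately show ?thesis by simp
  qed
  then have v1: "v \<bullet> v = 1" using v0 by (simp add: v_def)
  have Av: "A *\<^sub>v v = a \<cdot>\<^sub>v v"
    using v0 A by (simp add: v_def mult_mat_vec[of _ "Suc n" "Suc n"] smult_smult_assoc mult.commute)
  obtain H where H: "H \<in> carrier_mat (Suc n) (Suc n)" "transpose_mat H = H" "H * H = 1\<^sub>m (Suc n)" "col H 0 = v"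
    using orthogonal_with_first_column[OF v v1] by auto
  define B where "B = H * A * H"
  have B: "B \<in> carrier_mat (Suc n) (Suc n)" using H A by (simp add: B_def)
  have symB: "transpose_mat B = B"
    using H A sym by (simp add: B_def transpose_mult[of _ "Suc n" "Suc n" _ "Suc n"] assoc_mult_mat[of _ "Suc n" "Suc n" _ "Suc n" _ "Suc n"])
  have "col B 0 = H *\<^sub>v (A *\<^sub>v v)"
    using col_mult2[of "H * A" "Suc n" "Suc n" H "Suc n" 0] assoc_mult_mat_vec[OF H(1) A v] H A
    by (simp add: B_def del: col_mult2)
  also have "\<dots> = a \<cdot>\<^sub>v (H *\<^sub>v col H 0)" using H v by (simp add: Av mult_mat_vec[of _ "Suc n" "Suc n"])
  also have "H *\<^sub>v col H 0 = col (H * H) 0" using col_mult2[OF H(1) H(1), of 0] by simp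
  finally have "col B 0 = a \<cdot>\<^sub>v unit_vec (Suc n) 0" by (simp add: H(3))
  then have B0: "B $$ (i, 0) = (if i = 0 then a else 0)" if "i < Suc n" for i
    using that B by (metis (no_types, lifting) carrier_matD index_col index_smult_vec(1) index_unit_vec(1,3) mult.right_neutral mult_zero_right zero_less_Suc)
  have B0': "B $$ (0, i) = (if i = 0 then a else 0)" if "i < Suc n" for i
    using B0[OF that] symB B that by (metis carrier_matD index_transpose_mat(1) zero_less_Suc)
  define C where "C = Matrix.mat n n (\<lambda>(i, j). B $$ (Suc i, Suc j))"
  have C: "C \<in> carrier_mat n n" by (simp add: C_def)
  have "transpose_mat C = C"
    using symB B by (intro eq_matI) (auto simp: C_def, metis Suc_less_eq carrier_matD index_transpose_mat(1))
  from Suc.IH[OF C this] obtain W f where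
    W: "W \<in> carrier_mat n n" "transpose_mat W * W = 1\<^sub>m n" "C = W * mat_diag n f * transpose_mat W" by auto
  \<comment> \<open>\<open>case_nat a f\<close> puts the split-off eigenvalue \<open>a\<close> in
    front of the spectrum of the block.\<close>
  define D where "D = mat_diag (Suc n) (case_nat a f)"
  define X where "X = four_block_mat (1\<^sub>m 1) (0\<^sub>m 1 n) (0\<^sub>m n 1) W"
  have X: "X \<in> carrier_mat (Suc n) (Suc n)" using W by (auto simp: X_def)
  have XT: "transpose_mat X = four_block_mat (1\<^sub>m 1) (0\<^sub>m 1 n) (0\<^sub>m n 1) (transpose_mat W)"
    using W by (simp add: X_def transpose_four_block_mat[of _ 1 1 _ n _ n])
  have "transpose_mat X * X = four_block_mat (1\<^sub>m 1) (0\<^sub>m 1 n) (0\<^sub>m n 1) (1\<^sub>m n)"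
    unfolding XT using W by (simp add: X_def mult_four_block_mat[of _ 1 1 _ n _ n _ _ 1 _ n])
  also have "\<dots> = 1\<^sub>m (Suc n)" by (rule eq_matI) auto
  finally have XX: "transpose_mat X * X = 1\<^sub>m (Suc n)" .
  have D4: "D = four_block_mat (mat_diag 1 (\<lambda>_. a)) (0\<^sub>m 1 n) (0\<^sub>m n 1) (mat_diag n f)"
    by (rule eq_matI) (auto simp: D_def mat_diag_def split: nat.splits)
  have da: "mat_diag 1 (\<lambda>_. a) \<in> carrier_mat 1 1" by simp
  have WT: "transpose_mat W \<in> carrier_mat n n" using W by simp
  have "X * D * transpose_mat X = four_block_mat (1\<^sub>m 1 * mat_diag 1 (\<lambda>_. a) * 1\<^sub>m 1) (0\<^sub>m 1 n) (0\<^sub>m n 1) C"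
    unfolding XT unfolding D4 W(3) X_def
      block_diagonal_mult[OF one_carrier_mat W(1) da mat_diag_dim]
      block_diagonal_mult[OF mult_carrier_mat[OF one_carrier_mat da] mult_carrier_mat[OF W(1) mat_diag_dim] one_carrier_mat WT] ..
  also have "1\<^sub>m 1 * mat_diag 1 (\<lambda>_. a) * 1\<^sub>m 1 = mat_diag 1 (\<lambda>_. a)"
    unfolding left_mult_one_mat[OF da] by (rule right_mult_one_mat[OF da])
  also have "four_block_mat (mat_diag 1 (\<lambda>_. a)) (0\<^sub>m 1 n) (0\<^sub>m n 1) C = B"
    using B B0 B0' by (intro eq_matI) (auto simp: C_def mat_diag_def)
  finally have BX: "B = X * D * transpose_mat X" by simp
  have "A = H * B * H"
    using H A by (simp add: B_def assoc_mult_mat[of _ "Suc n" "Suc n" _ "Suc n" _ "Suc n"])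
      (simp flip: assoc_mult_mat[of _ "Suc n" "Suc n" _ "Suc n" _ "Suc n"])
  also have "\<dots> = (H * X) * D * transpose_mat (H * X)"
  proof -
    note asc = assoc_mult_mat[of _ "Suc n" "Suc n" _ "Suc n" _ "Suc n"]
    have c: "D \<in> carrier_mat (Suc n) (Suc n)" "transpose_mat X \<in> carrier_mat (Suc n) (Suc n)"
      using X by (auto simp: D_def)
    then have c2: "D * transpose_mat X \<in> carrier_mat (Suc n) (Suc n)" by simp
    have "X * (D * transpose_mat X) \<in> carrier_mat (Suc n) (Suc n)" using X c2 by simp
    then show ?thesis
      unfolding BX transpose_mult[OF H(1) X] H(2) using H(1) X c c2 by (simp add: asc)
  qed
  finally have "A = (H * X) * D * transpose_mat (H * X)" .
  moreover have "transpose_mat (H * X) * (H * X) = 1\<^sub>m (Suc n)"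
  proof -
    have "transpose_mat (H * X) * (H * X) = transpose_mat X * (H * (H * X))"
      unfolding transpose_mult[OF H(1) X] H(2)
      by (rule assoc_mult_mat[OF transpose_carrier_mat[THEN iffD2, OF X] H(1) mult_carrier_mat[OF H(1) X]])
    also have "H * (H * X) = X" using assoc_mult_mat[OF H(1) H(1) X] H(3) X by simp
    finally show ?thesis by (simp add: XX)
  qed
  moreover have "H * X \<in> carrier_mat (Suc n) (Suc n)" using H X by simp
  ultimately show ?case unfolding D_def by blast
qed

declare index_mult_mat_vec [simp del]


section \<open>Inverses and diagonal matrices\<close>

lemma minv_eqI:
  assumes A: "A \<in> carrier_mat n n" and B: "B \<in> carrier_mat n n" and AB: "A * B = 1\<^sub>m n"
  shows "minv A = B"
proof -
  have BA: "B * A = 1\<^sub>m n" using mat_mult_left_right_inverse[OF A B AB] .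
  have "A \<in> Units (ring_mat TYPE(real) n ())"
    using A B AB BA unfolding Units_def ring_mat_def by auto
  then obtain C where C: "mat_inverse A = Some C"
    using mat_inverse(1)[OF A, of "()"] by (cases "mat_inverse A") auto
  then have "C * A = 1\<^sub>m n" "C \<in> carrier_mat n n" using mat_inverse(2)[OF A C] by auto
  then have "C = C * (A * B)" using AB by simp
  also have "\<dots> = B" using A B \<open>C \<in> carrier_mat n n\<close> \<open>C * A = 1\<^sub>m n\<close>
    by (simp flip: assoc_mult_mat[of _ n n _ n _ n])
  finally show ?thesis using C by (simp add: minv_def)
qed

lemma mat_diag_cong: "(\<And>i. i < n \<Longrightarrow> f i = h i) \<Longrightarrow> mat_diag n f = mat_diag n h"
  by (rule eq_matI) (auto simp: mat_diag_def)

lemma dim_mat_diag [simp]: "dim_row (mat_diag n f) = n" "dim_col (mat_diag n f) = n"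
  by (simp_all add: mat_diag_def)

lemma mat_diag_pow: "mat_diag n f ^\<^sub>m k = mat_diag n (\<lambda>i. f i ^ k :: real)"
  by (induction k) (auto simp: mult.commute)

lemma index_mat_diag_mult_vec:
  assumes "w \<in> carrier_vec n" "i < n"
  shows "(mat_diag n f *\<^sub>v w) $ i = f i * (w $ i :: real)"
proof -
  have "(mat_diag n f *\<^sub>v w) $ i = (\<Sum>j\<in>{0..<n}. (if i = j then f j else 0) * w $ j)"
    using assms by (simp add: mat_diag_def index_mult_mat_vec scalar_prod_def)
  also have "\<dots> = (\<Sum>j\<in>{0..<n}. if j = i then f i * w $ i else 0)"
    by (intro sum.cong) auto
  finally show ?thesis using assms by simp
qed

lemma mat_diag_add_smult_one: "a \<cdot>\<^sub>m 1\<^sub>m n + mat_diag n f = mat_diag n (\<lambda>i. a + f i :: real)"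
  by (rule eq_matI) (auto simp: mat_diag_def)

lemma kernel_dim_cong:
  fixes A B :: "real mat"
  assumes "dim_col A = dim_col B" "mat_kernel A = mat_kernel B"
  shows "kernel_dim A = kernel_dim B"
  unfolding kernel_dim_def assms ..

section \<open>Adjoints and functional calculus for a weighted inner product\<close>

locale diagonal_gram =
  fixes n :: nat and g :: "nat \<Rightarrow> real"
  assumes pos: "i < n \<Longrightarrow> 0 < g i"
begin

lemma square_mult_carrier [simp]:
  "A \<in> carrier_mat n n \<Longrightarrow> B \<in> carrier_mat n n \<Longrightarrow> A * B \<in> carrier_mat n n"
  by (rule mult_carrier_mat)

lemma square_mult_one [simp]:
  "(A :: real mat) \<in> carrier_mat n n \<Longrightarrow> A * 1\<^sub>m n = A" "A \<in> carrier_mat n n \<Longrightarrow> 1\<^sub>m n * A = A"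
  by auto

lemma square_mult_vec_carrier [simp]:
  "A \<in> carrier_mat n n \<Longrightarrow> x \<in> carrier_vec n \<Longrightarrow> A *\<^sub>v x \<in> carrier_vec n"
  by (rule mult_mat_vec_carrier)

lemma square_mult_zero_vec: "(A :: real mat) \<in> carrier_mat n n \<Longrightarrow> A *\<^sub>v 0\<^sub>v n = 0\<^sub>v n"
  by (intro eq_vecI) (auto simp: index_mult_mat_vec)

abbreviation "ad \<equiv> adj (mat_diag n g)"

lemma minv_gram: "minv (mat_diag n g) = mat_diag n (\<lambda>i. 1 / g i)"
proof (rule minv_eqI[of _ n])
  have "mat_diag n (\<lambda>i. g i * (1 / g i)) = mat_diag n (\<lambda>_. 1)"
    using pos by (intro mat_diag_cong) (simp add: less_imp_neq[THEN not_sym])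
  then show "mat_diag n g * mat_diag n (\<lambda>i. 1 / g i) = 1\<^sub>m n" by simp
qed auto

text \<open>Both Hodge stars on 0-cochains and the identity are positive diagonal Gram matrices, and
  for these the adjoint is explicit entry by entry. The algebraic rules for \<open>ad\<close> come
  from this formula.\<close>

lemma ad_conv:
  assumes "A \<in> carrier_mat n n"
  shows "ad A = Matrix.mat n n (\<lambda>(i, j). g j * A $$ (j, i) / g i)"
  using assms unfolding adj_def minv_gram
  by (subst mat_diag_mult_left[of _ n n], simp, subst mat_diag_mult_right[of _ n n], simp)
     (auto intro!: eq_matI)

lemma ad_carrier [simp]: "A \<in> carrier_mat n n \<Longrightarrow> ad A \<in> carrier_mat n n"
  by (simp add: ad_conv)

lemma ad_ad:
  assumes A: "A \<in> carrier_mat n n"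
  shows "ad (ad A) = A"
proof -
  have "ad (ad A) = Matrix.mat n n (\<lambda>(i, j). g j * ad A $$ (j, i) / g i)"
    using A by (intro ad_conv) simp
  also have "\<dots> = A"
    using A pos by (intro eq_matI) (auto simp: ad_conv less_imp_neq[THEN not_sym])
  finally show ?thesis .
qed

lemma ad_mult:
  assumes A: "A \<in> carrier_mat n n" and B: "B \<in> carrier_mat n n"
  shows "ad (A * B) = ad B * ad A"
proof (rule eq_matI)
  fix i j assume "i < dim_row (ad B * ad A)" "j < dim_col (ad B * ad A)"
  then have ij: "i < n" "j < n" using A B by (auto simp: ad_conv)
  have "ad (A * B) $$ (i, j) = g j * (\<Sum>k<n. A $$ (j, k) * B $$ (k, i)) / g i"
    using A B ij by (simp add: ad_conv[of "A * B"] scalar_prod_def atLeast0LessThan)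
  also have "\<dots> = (\<Sum>k<n. (g k * B $$ (k, i) / g i) * (g j * A $$ (j, k) / g k))"
    unfolding sum_distrib_left sum_divide_distrib
    using pos by (intro sum.cong) (auto simp: less_imp_neq[THEN not_sym] field_simps)
  also have "\<dots> = (ad B * ad A) $$ (i, j)"
    using A B ij by (simp add: ad_conv scalar_prod_def atLeast0LessThan)
  finally show "ad (A * B) $$ (i, j) = (ad B * ad A) $$ (i, j)" .
qed (use A B in \<open>auto simp: ad_conv[of "A * B"] ad_conv\<close>)

lemma ad_diag [simp]: "ad (mat_diag n f) = mat_diag n f"
  using pos by (subst ad_conv, simp) (auto intro!: eq_matI simp: mat_diag_def less_imp_neq[THEN not_sym])

text \<open>An isometry of the weighted space to itself: the condition amounts to
  \<open>transpose_mat V * G * V = G\<close> with \<open>G = mat_diag n g\<close>. The columns are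
  thus orthogonal for \<open>G\<close>, with column \<open>i\<close> of squared length
  \<open>g i\<close> rather than one.\<close>

definition unitary :: "real mat \<Rightarrow> bool" where
  "unitary V \<longleftrightarrow> V \<in> carrier_mat n n \<and> ad V * V = 1\<^sub>m n"

lemma unitaryD:
  assumes "unitary V"
  shows "V \<in> carrier_mat n n" "ad V \<in> carrier_mat n n" "ad V * V = 1\<^sub>m n" "V * ad V = 1\<^sub>m n"
  using assms mat_mult_left_right_inverse[of "ad V" n V] by (auto simp: unitary_def)

lemmas sq_assoc = assoc_mult_mat[of _ n n _ n _ n]

lemma mult_unitary_cancel:
  assumes V: "unitary V" and A: "A \<in> carrier_mat n n"
  shows "ad V * (V * A) = A" "V * (ad V * A) = A" "A * V * ad V = A" "A * ad V * V = A"
proof -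
  note u = unitaryD[OF V]
  show "ad V * (V * A) = A" "V * (ad V * A) = A"
    using u A by (simp_all flip: sq_assoc)
  show "A * V * ad V = A" "A * ad V * V = A"
    using u A by (simp_all add: sq_assoc)
qed

text \<open>The function \<open>f\<close> of an operator with orthonormal eigenbasis \<open>V\<close>.\<close>

definition fc :: "real mat \<Rightarrow> (nat \<Rightarrow> real) \<Rightarrow> real mat" where
  "fc V f = V * mat_diag n f * ad V"

lemma fc_carrier [simp]: "unitary V \<Longrightarrow> fc V f \<in> carrier_mat n n"
  unfolding fc_def using unitaryD[of V] by auto

lemma fc_cong: "(\<And>i. i < n \<Longrightarrow> f i = h i) \<Longrightarrow> fc V f = fc V h"
  unfolding fc_def using mat_diag_cong[of n f h] by simp

lemma fc_mult:
  assumes V: "unitary V"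
  shows "fc V f * fc V h = fc V (\<lambda>i. f i * h i)"
proof -
  note u = unitaryD[OF V]
  have "fc V f * fc V h = V * mat_diag n f * (ad V * (V * (mat_diag n h * ad V)))"
    unfolding fc_def using u by (simp add: sq_assoc)
  also have "\<dots> = V * (mat_diag n f * mat_diag n h) * ad V"
    using u by (simp add: mult_unitary_cancel[OF V] sq_assoc del: mat_diag_diag)
  finally show ?thesis by (simp add: fc_def)
qed

lemma fc_one: "unitary V \<Longrightarrow> fc V (\<lambda>_. 1) = 1\<^sub>m n"
  using unitaryD[of V] by (simp add: fc_def)

lemma fc_add_smult_one:
  assumes V: "unitary V"
  shows "a \<cdot>\<^sub>m 1\<^sub>m n + fc V f = fc V (\<lambda>i. a + f i)"
proof -
  note u = unitaryD[OF V]
  have "fc V (\<lambda>i. a + f i) = V * (a \<cdot>\<^sub>m 1\<^sub>m n + mat_diag n f) * ad V"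
    by (simp add: fc_def mat_diag_add_smult_one)
  also have "\<dots> = V * (a \<cdot>\<^sub>m 1\<^sub>m n) * ad V + fc V f"
    unfolding fc_def using u
    by (simp add: mult_add_distrib_mat[of _ n n _ n] add_mult_distrib_mat[of _ n n _ _ n])
  also have "V * (a \<cdot>\<^sub>m 1\<^sub>m n) * ad V = a \<cdot>\<^sub>m 1\<^sub>m n"
    using u by (simp add: mult_smult_distrib[of _ n n _ n] mult_smult_assoc_mat[of _ n n _ n])
  finally show ?thesis by simp
qed

lemma ad_fc:
  assumes V: "unitary V"
  shows "ad (fc V f) = fc V f"
  using unitaryD[OF V] by (simp add: fc_def ad_mult ad_ad sq_assoc)

lemma fc_pow: "unitary V \<Longrightarrow> fc V f ^\<^sub>m k = fc V (\<lambda>i. f i ^ k)"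
  using carrier_matD[OF fc_carrier[of V f]]
  by (induction k) (auto simp: fc_one fc_mult mult.commute)

lemma fc_mult_inverse:
  assumes V: "unitary V" and f: "\<And>i. i < n \<Longrightarrow> f i \<noteq> 0"
  shows "fc V f * fc V (\<lambda>i. 1 / f i) = 1\<^sub>m n"
  unfolding fc_mult[OF V] fc_one[OF V, symmetric] using f by (intro fc_cong) simp

lemma minv_fc:
  assumes V: "unitary V" and f: "\<And>i. i < n \<Longrightarrow> f i \<noteq> 0"
  shows "minv (fc V f) = fc V (\<lambda>i. 1 / f i)"
  using fc_mult_inverse[OF assms] V by (intro minv_eqI[of _ n]) auto

lemma invertible_fc:
  assumes V: "unitary V" and f: "\<And>i. i < n \<Longrightarrow> f i \<noteq> 0"
  shows "invertible_mat (fc V f)"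
proof -
  have "fc V (\<lambda>i. 1 / f i) * fc V f = 1\<^sub>m n"
    by (rule mat_mult_left_right_inverse[OF fc_carrier[OF V] fc_carrier[OF V] fc_mult_inverse[OF assms]])
  moreover have "fc V f * fc V (\<lambda>i. 1 / f i) = 1\<^sub>m n" by (rule fc_mult_inverse[OF assms])
  moreover have "dim_row (fc V h) = n" "dim_col (fc V h) = n" for h
    using fc_carrier[OF V, of h] by (rule carrier_matD)+
  ultimately show ?thesis
    unfolding invertible_mat_def inverts_mat_def square_mat.simps
    by (intro conjI exI[of _ "fc V (\<lambda>i. 1 / f i)"]) (simp_all only:)
qed

text \<open>The root \<open>D\<close> of the Gram matrix is an isometry from the weighted to the
  Euclidean inner product, so it carries \<open>L\<close> to the symmetric matrix \<open>K\<close>,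
  whose eigenbasis is pulled back.\<close>

lemma selfadjoint_spectral:
  assumes L: "L \<in> carrier_mat n n" and sa: "ad L = L"
  shows "\<exists>V f. unitary V \<and> L = fc V f"
proof -
  define r where "r i = sqrt (g i)" for i
  have r: "r i \<noteq> 0" "r i * r i = g i" if "i < n" for i using pos[OF that] by (auto simp: r_def)
  define D where "D = mat_diag n r"
  define E where "E = mat_diag n (\<lambda>i. 1 / r i)"
  have DE: "D \<in> carrier_mat n n" "E \<in> carrier_mat n n" by (auto simp: D_def E_def)
  have one: "mat_diag n (\<lambda>i. r i * (1 / r i)) = mat_diag n (\<lambda>_. 1)" "mat_diag n (\<lambda>i. 1 / r i * r i) = mat_diag n (\<lambda>_. 1)"
    by (rule mat_diag_cong, simp add: r)+
  have inv: "D * E = 1\<^sub>m n" "E * D = 1\<^sub>m n"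
    unfolding D_def E_def mat_diag_diag one by auto
  have D1: "D * (E * A) = A" "E * (D * A) = A" if "A \<in> carrier_mat n n" for A
    using DE inv that by (simp_all flip: sq_assoc)
  have ED_conv: "E * A * D = Matrix.mat n n (\<lambda>(i, j). A $$ (i, j) * r j / r i)" 
    "D * A * E = Matrix.mat n n (\<lambda>(i, j). r i * A $$ (i, j) / r j)"
    if "A \<in> carrier_mat n n" for A
    unfolding D_def E_def mat_diag_mult_left[OF that] mat_diag_mult_right[OF mat_carrier]
    by (auto intro!: cong_mat)
  define K where "K = D * L * E"
  have K: "K \<in> carrier_mat n n" using DE L by (simp add: K_def)
  \<comment> \<open>Self-adjointness is symmetry of \<open>G * L\<close> for the Gram matrix
    \<open>G\<close>; dividing this relation by \<open>r i * r j\<close> gives symmetry of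
    \<open>K\<close>.\<close>
  have entry: "g j * L $$ (j, i) = g i * L $$ (i, j)" if "i < n" "j < n" for i j
    using arg_cong[OF sa, of "\<lambda>A. A $$ (i, j)"] that L pos[of i] by (simp add: ad_conv field_simps)
  have "transpose_mat K = K"
  proof (rule eq_matI)
    fix i j assume "i < dim_row K" "j < dim_col K"
    then have ij: "i < n" "j < n" using K by auto
    have "r j * (r j * L $$ (j, i)) = r i * (r i * L $$ (i, j))"
      using entry[OF ij] r(2)[OF ij(1)] r(2)[OF ij(2)] by (simp flip: mult.assoc)
    then have "r j * L $$ (j, i) / r i = r i * L $$ (i, j) / r j"
      using r(1)[OF ij(1)] r(1)[OF ij(2)] by (simp add: field_simps)
    then show "transpose_mat K $$ (i, j) = K $$ (i, j)"
      unfolding K_def ED_conv(2)[OF L] using ij by simp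
  qed (use K in auto)
  from symmetric_spectral[OF K this] obtain W f where
    W: "W \<in> carrier_mat n n" "transpose_mat W * W = 1\<^sub>m n" "K = W * mat_diag n f * transpose_mat W" by auto
  \<comment> \<open>The columns of \<open>E * W\<close> would have length one for the Gram matrix.
    The factor \<open>D\<close> on the right rescales them as \<open>unitary\<close> demands, and it
    commutes with \<open>mat_diag n f\<close>, so the operator is unchanged.\<close>
  define V where "V = E * W * D"
  have V: "V \<in> carrier_mat n n" using DE W by (simp add: V_def)
  have adV: "ad V = E * transpose_mat W * D"
  proof -
    have WT: "transpose_mat W \<in> carrier_mat n n" using W by simp
    have key: "g j * (a * r i / r j) / g i = a * r j / r i" if "i < n" "j < n" for i j a
      using r(1)[OF that(1)] r(1)[OF that(2)]
      unfolding r(2)[OF that(1), symmetric] r(2)[OF that(2), symmetric] by (simp add: field_simps)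
    show ?thesis unfolding ad_conv[OF V] unfolding V_def ED_conv(1)[OF W(1)] ED_conv(1)[OF WT]
    proof (rule cong_mat)
      fix i j assume ij: "i < n" "j < n"
      then show "(case (i, j) of (i, j) \<Rightarrow> g j * Matrix.mat n n (\<lambda>(i, j). W $$ (i, j) * r j / r i) $$ (j, i) / g i) =
        (case (i, j) of (i, j) \<Rightarrow> transpose_mat W $$ (i, j) * r j / r i)"
        using key[OF ij, of "W $$ (j, i)"] W(1) by simp
    qed auto
  qed
  have WT: "transpose_mat W \<in> carrier_mat n n" using W by simp
  have "ad V * V = E * (transpose_mat W * W) * D"
    unfolding adV unfolding V_def using DE W(1) WT by (simp add: sq_assoc D1)
  also have "\<dots> = 1\<^sub>m n" using W(2) DE inv by simp
  finally have uV: "unitary V" using V by (simp add: unitary_def)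
  have comm: "D * mat_diag n f * E = mat_diag n f"
    unfolding D_def E_def mat_diag_diag using r by (intro mat_diag_cong) simp
  have "fc V f = E * W * (D * mat_diag n f * E) * (transpose_mat W * D)"
    unfolding fc_def adV unfolding V_def using DE W(1) WT by (simp add: sq_assoc)
  also have "\<dots> = E * K * D" unfolding comm W(3) using DE W(1) WT by (simp add: sq_assoc)
  also have "\<dots> = L" unfolding K_def using DE L inv by (simp add: sq_assoc D1)
  finally show ?thesis using uV by blast
qed

text \<open>The change of basis \<open>X\<close> intertwines the squared diagonals. Where an entry
  of \<open>X\<close> is nonzero, \<open>t i\<close> and \<open>s j\<close> have equal squares,
  hence are equal because both are nonnegative. So \<open>X\<close> intertwines the diagonals
  themselves. Comparing entries this way copes with repeated eigenvalues, for which \<open>X\<close>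
  need not be a permutation.\<close>

lemma fc_nonneg_root_unique:
  assumes V: "unitary V" and W: "unitary W"
    and s: "\<And>i. i < n \<Longrightarrow> 0 \<le> s i" and t: "\<And>i. i < n \<Longrightarrow> 0 \<le> t i"
    and eq: "fc V (\<lambda>i. s i * s i) = fc W (\<lambda>i. t i * t i)"
  shows "fc V s = fc W t"
proof -
  note v = unitaryD[OF V] and w = unitaryD[OF W]
  define X where "X = ad W * V"
  have X: "X \<in> carrier_mat n n" using v w by (simp add: X_def)
  have "mat_diag n (\<lambda>i. t i * t i) * X = ad W * fc W (\<lambda>i. t i * t i) * V"
    unfolding fc_def X_def using v w by (simp add: sq_assoc mult_unitary_cancel[OF W])
  also have "\<dots> = X * mat_diag n (\<lambda>i. s i * s i)"
    unfolding eq[symmetric] unfolding fc_def X_def using v w by (simp add: sq_assoc)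
  finally have TX2: "mat_diag n (\<lambda>i. t i * t i) * X = X * mat_diag n (\<lambda>i. s i * s i)" .
  have e: "t i * t i * X $$ (i, j) = X $$ (i, j) * (s j * s j)" if ij: "i < n" "j < n" for i j
  proof -
    have "(mat_diag n (\<lambda>i. t i * t i) * X) $$ (i, j) = (X * mat_diag n (\<lambda>i. s i * s i)) $$ (i, j)"
      by (simp only: TX2)
    then show ?thesis unfolding mat_diag_mult_left[OF X] mat_diag_mult_right[OF X] using ij by simp
  qed
  have TX: "mat_diag n t * X = X * mat_diag n s"
    unfolding mat_diag_mult_left[OF X] mat_diag_mult_right[OF X]
  proof (rule cong_mat)
    fix i j assume ij: "i < n" "j < n"
    show "(case (i, j) of (i, j) \<Rightarrow> t i * X $$ (i, j)) = (case (i, j) of (i, j) \<Rightarrow> X $$ (i, j) * s j)"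
    proof (cases "X $$ (i, j) = 0")
      case False
      then have "(t i)\<^sup>2 = (s j)\<^sup>2" using e[OF ij] by (simp add: power2_eq_square)
      then have "t i = s j" using s[OF ij(2)] t[OF ij(1)] by (simp add: power2_eq_iff_nonneg)
      then show ?thesis by simp
    qed simp
  qed auto
  have "fc W t = W * (mat_diag n t * X) * ad V"
    unfolding fc_def X_def using v w by (simp add: sq_assoc)
  also have "\<dots> = fc V s"
    unfolding TX unfolding X_def fc_def using v w by (simp add: sq_assoc mult_unitary_cancel[OF W])
  finally show ?thesis by simp
qed

section \<open>Eigenspaces and eigenprojections of functions of an operator\<close>

lemma fc_mult_vec:
  assumes V: "unitary V" and x: "x \<in> carrier_vec n"
  shows "fc V f *\<^sub>v x = V *\<^sub>v (mat_diag n f *\<^sub>v (ad V *\<^sub>v x))"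
  unfolding fc_def using unitaryD[OF V] x
  by (simp add: assoc_mult_mat_vec[of _ n n _ n])

lemma unitary_vec_cancel:
  assumes V: "unitary V" and x: "x \<in> carrier_vec n"
  shows "ad V *\<^sub>v (V *\<^sub>v x) = x" "V *\<^sub>v (ad V *\<^sub>v x) = x"
  using unitaryD[OF V] x by (simp_all flip: assoc_mult_mat_vec[of _ n n _ n])

text \<open>In the coordinates \<open>ad V *\<^sub>v x\<close> the operator is diagonal. The form of
  the right-hand side is chosen so that \<open>f\<close> and \<mu> enter only through the set of
  indices with \<open>f j = \<mu>\<close>.\<close>

lemma kernel_char_fc:
  assumes V: "unitary V"
  shows "mat_kernel (char_matrix (fc V f) \<mu>) =
    {x \<in> carrier_vec n. \<forall>j < n. f j \<noteq> \<mu> \<longrightarrow> (ad V *\<^sub>v x) $ j = 0}"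
proof -
  note u = unitaryD[OF V]
  have ch: "char_matrix (fc V f) \<mu> = fc V (\<lambda>i. f i - \<mu>)"
    using fc_add_smult_one[OF V, of "- \<mu>" f] carrier_matD[OF fc_carrier[OF V, of f]]
      comm_add_mat[of "fc V f" n n "(-\<mu>) \<cdot>\<^sub>m 1\<^sub>m n"] V
    by (simp add: char_matrix_def)
  have "fc V (\<lambda>i. f i - \<mu>) *\<^sub>v x = 0\<^sub>v n \<longleftrightarrow> (\<forall>j < n. f j \<noteq> \<mu> \<longrightarrow> (ad V *\<^sub>v x) $ j = 0)"
    if x: "x \<in> carrier_vec n" for x
  proof -
    let ?w = "mat_diag n (\<lambda>i. f i - \<mu>) *\<^sub>v (ad V *\<^sub>v x)"
    have adx: "ad V *\<^sub>v x \<in> carrier_vec n" using u x by simp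
    have w: "?w \<in> carrier_vec n" using mult_mat_vec_carrier[OF mat_diag_dim adx] .
    have "fc V (\<lambda>i. f i - \<mu>) *\<^sub>v x = 0\<^sub>v n \<longleftrightarrow> ?w = 0\<^sub>v n"
    proof
      assume "fc V (\<lambda>i. f i - \<mu>) *\<^sub>v x = 0\<^sub>v n"
      then have "V *\<^sub>v ?w = 0\<^sub>v n" by (simp only: fc_mult_vec[OF V x])
      then have "ad V *\<^sub>v 0\<^sub>v n = ?w" using unitary_vec_cancel(1)[OF V w] by simp
      then show "?w = 0\<^sub>v n" using u by (metis square_mult_zero_vec)
    next
      assume "?w = 0\<^sub>v n"
      then show "fc V (\<lambda>i. f i - \<mu>) *\<^sub>v x = 0\<^sub>v n"
        unfolding fc_mult_vec[OF V x] using u by (metis square_mult_zero_vec)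
    qed
    also have "\<dots> \<longleftrightarrow> (\<forall>j < n. ?w $ j = 0)"
      using w by (metis carrier_vecD eq_vecI index_zero_vec(1) index_zero_vec(2))
    also have "\<dots> \<longleftrightarrow> (\<forall>j < n. f j \<noteq> \<mu> \<longrightarrow> (ad V *\<^sub>v x) $ j = 0)"
      using index_mat_diag_mult_vec[OF adx] by auto
    finally show ?thesis .
  qed
  then show ?thesis
    unfolding ch using mat_kernel[OF fc_carrier[OF V]] by auto
qed

lemma eigenvalue_fc:
  assumes V: "unitary V"
  shows "eigenvalue (fc V f) \<mu> \<longleftrightarrow> (\<exists>i < n. f i = \<mu>)"
proof -
  note u = unitaryD[OF V]
  have "eigenvalue (fc V f) \<mu> \<longleftrightarrow> (\<exists>x. x \<noteq> 0\<^sub>v n \<and> x \<in> mat_kernel (char_matrix (fc V f) \<mu>))"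
    using V by (subst eigenvalue_char_matrix[of _ n]) (auto simp: mat_kernel[of _ n n])
  also have "\<dots> \<longleftrightarrow> (\<exists>i < n. f i = \<mu>)"
  proof
    assume "\<exists>x. x \<noteq> 0\<^sub>v n \<and> x \<in> mat_kernel (char_matrix (fc V f) \<mu>)"
    then obtain x where x: "x \<noteq> 0\<^sub>v n" "x \<in> carrier_vec n" "\<forall>j < n. f j \<noteq> \<mu> \<longrightarrow> (ad V *\<^sub>v x) $ j = 0"
      by (auto simp: kernel_char_fc[OF V])
    show "\<exists>i < n. f i = \<mu>"
    proof (rule ccontr)
      assume "\<not> ?thesis"
      then have "ad V *\<^sub>v x = 0\<^sub>v n"
        using x carrier_vecD[OF mult_mat_vec_carrier[OF u(2) x(2)]] by (intro eq_vecI) auto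
      then have "x = V *\<^sub>v 0\<^sub>v n" using unitary_vec_cancel(2)[OF V x(2)] by simp
      then show False using x(1) u by (metis square_mult_zero_vec)
    qed
  next
    assume "\<exists>i < n. f i = \<mu>"
    then obtain i where i: "i < n" "f i = \<mu>" by auto
    let ?x = "V *\<^sub>v unit_vec n i"
    have a: "ad V *\<^sub>v ?x = unit_vec n i" using unitary_vec_cancel(1)[OF V, of "unit_vec n i"] by simp
    have "?x \<noteq> 0\<^sub>v n"
    proof
      assume "?x = 0\<^sub>v n"
      then have "unit_vec n i = (0\<^sub>v n :: real vec)" using a u by (metis square_mult_zero_vec)
      then show False using i(1) by (metis index_unit_vec(2) index_zero_vec(1) zero_neq_one)
    qed
    moreover have "?x \<in> mat_kernel (char_matrix (fc V f) \<mu>)"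
      using u i by (auto simp: kernel_char_fc[OF V] a)
    ultimately show "\<exists>x. x \<noteq> 0\<^sub>v n \<and> x \<in> mat_kernel (char_matrix (fc V f) \<mu>)" by blast
  qed
  finally show ?thesis .
qed

text \<open>The eigenspace of \<open>f i\<close> is determined by the indices at which
  \<open>f\<close> takes that value. The hypothesis makes these the indices at which
  \<open>h\<close> takes the value \<open>h i\<close>, so the same subspace is an eigenspace of the
  other operator, for the eigenvalue \<open>h i\<close>.\<close>

lemma eigenprojections_fc_subset:
  assumes V: "unitary V" and fh: "\<And>i j. i < n \<Longrightarrow> j < n \<Longrightarrow> f i = f j \<longleftrightarrow> h i = h j"
  shows "eigenprojections (mat_diag n g) (fc V f) k \<subseteq> eigenprojections (mat_diag n g) (fc V h) k"
proof
  fix Q assume "Q \<in> eigenprojections (mat_diag n g) (fc V f) k"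
  then obtain i where i: "i < n" "kernel_dim (char_matrix (fc V f) (f i)) = k"
      "is_orthogonal_projection (mat_diag n g) (mat_kernel (char_matrix (fc V f) (f i))) Q"
    by (auto simp: eigenprojections_def eigenvalue_fc[OF V])
  have ker: "mat_kernel (char_matrix (fc V f) (f i)) = mat_kernel (char_matrix (fc V h) (h i))"
    using fh i(1) by (auto simp: kernel_char_fc[OF V])
  have "dim_col (char_matrix (fc V f) (f i)) = dim_col (char_matrix (fc V h) (h i))"
    using char_matrix_closed[OF fc_carrier[OF V]] by (metis carrier_matD(2))
  from kernel_dim_cong[OF this ker] i show "Q \<in> eigenprojections (mat_diag n g) (fc V h) k"
    unfolding eigenprojections_def ker by (auto simp: eigenvalue_fc[OF V])
qed

lemma eigenprojections_fc_cong:
  assumes "unitary V" "\<And>i j. i < n \<Longrightarrow> j < n \<Longrightarrow> f i = f j \<longleftrightarrow> h i = h j"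
  shows "eigenprojections (mat_diag n g) (fc V f) k = eigenprojections (mat_diag n g) (fc V h) k"
  using eigenprojections_fc_subset[of V f h k] eigenprojections_fc_subset[of V h f k] assms by blast

section \<open>Precision and covariance in terms of singular vectors\<close>

lemma precision_fc:
  assumes V: "unitary V"
  shows "precision (mat_diag n g) (fc V s) \<alpha> \<kappa> = fc V (\<lambda>i. (\<kappa>\<^sup>2 + s i) ^ \<alpha>)"
proof -
  have "shifted \<kappa> (fc V s) = fc V (\<lambda>i. \<kappa>\<^sup>2 + s i)"
    using carrier_matD[OF fc_carrier[OF V, of s]] by (simp add: shifted_def fc_add_smult_one[OF V])
  \<comment> \<open>The adjoint acts trivially on a real function of a self-adjoint operator, so the
    two powers of the shifted operator multiply and their exponents, the lower and upper halves of
    \<alpha>, add up.\<close>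
  moreover have "\<alpha> div 2 + (\<alpha> + 1) div 2 = \<alpha>" by simp
  ultimately show ?thesis
    unfolding precision_def by (simp add: fc_pow[OF V] ad_fc[OF V] fc_mult[OF V] flip: power_add)
qed

text \<open>Adjoints and SVDs refer to \<open>g\<close>, whereas nonnegativity is tested with
  \<open>h\<close>. The two can be separated because an eigenvalue does not depend on the inner
  product.\<close>

theorem nonneg_selfadjoint_svd_calculus:
  assumes L: "L \<in> carrier_mat n n" and sa: "ad L = L"
    and h: "\<And>i. i < n \<Longrightarrow> 0 < h i"
    and psd: "\<And>x. x \<in> carrier_vec n \<Longrightarrow> 0 \<le> (\<Sum>i<n. h i * x $ i * (L *\<^sub>v x) $ i)"
  defines "G \<equiv> mat_diag n g"
  shows "\<exists>U S V. is_svd G L U S V \<and> null_vectors_paired U S V" (is ?exists)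
    and "\<forall>U S V. is_svd G L U S V \<longrightarrow> (\<forall>\<kappa> \<alpha>. \<kappa> \<noteq> 0 \<longrightarrow>
        (null_vectors_paired U S V \<longrightarrow>
           shifted \<kappa> L = U * (\<kappa>\<^sup>2 \<cdot>\<^sub>m 1\<^sub>m n + S) * adj G V) \<and>
        invertible_mat (precision G L \<alpha> \<kappa>) \<and>
        minv (covariance G L \<alpha> \<kappa>) = V * (\<kappa>\<^sup>2 \<cdot>\<^sub>m 1\<^sub>m n + S) ^\<^sub>m \<alpha> * adj G V)" (is ?svd)
    and "\<forall>k \<alpha> \<alpha>' \<kappa> \<kappa>'. 1 \<le> \<alpha> \<and> 1 \<le> \<alpha>' \<and> \<kappa> \<noteq> 0 \<and> \<kappa>' \<noteq> 0 \<longrightarrow>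
        eigenprojections G (covariance G L \<alpha> \<kappa>) k = eigenprojections G (covariance G L \<alpha>' \<kappa>') k" (is ?proj)
proof -
  obtain W t where W: "unitary W" and LW: "L = fc W t" using selfadjoint_spectral[OF L sa] by blast
  note w = unitaryD[OF W]
  \<comment> \<open>On an eigenvector the \<open>h\<close>-form equals \<open>t i\<close> times a
    positive squared length, so nonnegativity of the form gives the sign of
    \<open>t i\<close>.\<close>
  have t: "0 \<le> t i" if i: "i < n" for i
  proof -
    let ?x = "W *\<^sub>v unit_vec n i"
    have x: "?x \<in> carrier_vec n" using w by simp
    have a: "ad W *\<^sub>v ?x = unit_vec n i" using unitary_vec_cancel(1)[OF W, of "unit_vec n i"] by simp
    have "mat_diag n t *\<^sub>v unit_vec n i = t i \<cdot>\<^sub>v unit_vec n i"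
      using i mult_mat_vec_carrier[OF mat_diag_dim[of n t], of "unit_vec n i"]
      by (intro eq_vecI) (auto simp: index_mat_diag_mult_vec simp del: mult_mat_vec_carrier)
    then have Lx: "L *\<^sub>v ?x = t i \<cdot>\<^sub>v ?x"
      using w unfolding LW fc_mult_vec[OF W x] a by (simp add: mult_mat_vec[of _ n n])
    have x0: "?x \<noteq> 0\<^sub>v n"
    proof
      assume "?x = 0\<^sub>v n"
      then have "unit_vec n i = (0\<^sub>v n :: real vec)" using a w by (metis square_mult_zero_vec)
      then show False using i by (metis index_unit_vec(2) index_zero_vec(1) zero_neq_one)
    qed
    then obtain j where j: "j < n" "?x $ j \<noteq> 0"
      using x by (metis carrier_vecD eq_vecI index_zero_vec(1) index_zero_vec(2))
    have "0 < ?x $ j * ?x $ j"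
      using j(2) by (metis linorder_neqE_linordered_idom mult_eq_0_iff not_square_less_zero)
    then have "0 < h j * (?x $ j * ?x $ j)" using h[OF j(1)] by simp
    moreover have "0 \<le> h l * (?x $ l * ?x $ l)" if "l < n" for l using h[OF that] by simp
    ultimately have "0 < (\<Sum>i<n. h i * (?x $ i * ?x $ i))"
      using j(1) by (intro sum_pos2[of _ j]) auto
    moreover have "(\<Sum>j<n. h j * ?x $ j * (L *\<^sub>v ?x) $ j) = t i * (\<Sum>i<n. h i * (?x $ i * ?x $ i))"
      unfolding Lx sum_distrib_left using carrier_matD[OF w(1)] by (intro sum.cong) auto
    ultimately show ?thesis using psd[OF x] by (simp add: zero_le_mult_iff)
  qed
  \<comment> \<open>With nonnegative eigenvalues a spectral decomposition is already an SVD; its two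
    bases coincide, so null vectors are paired.\<close>
  have "is_svd G L W (mat_diag n t) W"
    using w L t unfolding is_svd_def G_def Let_def
    by (auto simp: LW fc_def mat_diag_def diagonal_mat_def)
  then show ?exists unfolding null_vectors_paired_def by blast
  show ?svd
  proof (intro allI impI)
    fix U S V and \<kappa> :: real and \<alpha> :: nat
    assume svd: "is_svd G L U S V" and \<kappa>: "\<kappa> \<noteq> 0"
    define s where "s i = S $$ (i, i)" for i
    from svd L have U: "unitary U" and V: "unitary V" and s: "\<And>i. i < n \<Longrightarrow> 0 \<le> s i"
      and Sc: "S \<in> carrier_mat n n" and dS: "diagonal_mat S" and LUV: "L = U * S * ad V"
      unfolding is_svd_def Let_def G_def unitary_def s_def by auto
    have S: "S = mat_diag n s"
      using Sc dS by (intro eq_matI) (auto simp: mat_diag_def s_def diagonal_mat_def)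
    note u = unitaryD[OF U] and v = unitaryD[OF V]
    \<comment> \<open>An arbitrary \<open>U\<close> cancels in \<open>ad L * L\<close>. This leaves
      two nonnegative diagonalizations of the same operator, one from the given SVD and one from the
      spectral theorem.\<close>
    have "ad L * L = V * S * (ad U * (U * (S * ad V)))"
      unfolding LUV using u v Sc by (simp add: ad_mult ad_ad sq_assoc) (simp add: S)
    also have "\<dots> = fc V (\<lambda>i. s i * s i)"
      using u v Sc unfolding mult_unitary_cancel(1)[OF U mult_carrier_mat[OF Sc v(2)]]
      by (simp add: fc_def S sq_assoc flip: mat_diag_diag)
    also have "ad L * L = fc W (\<lambda>i. t i * t i)" unfolding sa by (simp add: LW fc_mult[OF W])
    finally have "L = fc V s" using fc_nonneg_root_unique[OF V W s t] by (simp add: LW)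
    have sh: "\<kappa>\<^sup>2 \<cdot>\<^sub>m 1\<^sub>m n + S = mat_diag n (\<lambda>i. \<kappa>\<^sup>2 + s i)"
      by (simp add: S mat_diag_add_smult_one)
    \<comment> \<open>Cancelling \<open>ad V\<close> from the two expressions for \<open>L\<close>
      gives \<open>U * S = V * S\<close>. Columns with a nonzero singular value therefore agree, and
      pairing supplies the others.\<close>
    have "U = V" if null: "null_vectors_paired U S V"
    proof (rule eq_matI)
      fix i j assume "i < dim_row V" "j < dim_col V"
      then have ij: "i < n" "j < n" using v by auto
      have "U * S * ad V * V = V * S * ad V * V" using \<open>L = fc V s\<close> LUV by (simp add: fc_def S)
      then have "U * S = V * S"
        using mult_unitary_cancel(4)[OF V mult_carrier_mat[OF u(1) Sc]]
          mult_unitary_cancel(4)[OF V mult_carrier_mat[OF v(1) Sc]] by simp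
      then have "(U * S) $$ (i, j) = (V * S) $$ (i, j)" by simp
      then have e: "U $$ (i, j) * s j = V $$ (i, j) * s j"
        using u v ij unfolding S by (simp add: mat_diag_mult_right[of _ n n])
      show "U $$ (i, j) = V $$ (i, j)"
      proof (cases "s j = 0")
        case True
        then have "col U j = col V j" using null ij Sc by (auto simp: null_vectors_paired_def s_def)
        then show ?thesis using u v ij by (metis carrier_matD index_col)
      qed (use e in simp)
    qed (use u v in auto)
    then have "null_vectors_paired U S V \<Longrightarrow> shifted \<kappa> L = U * (\<kappa>\<^sup>2 \<cdot>\<^sub>m 1\<^sub>m n + S) * adj G V"
      unfolding shifted_def sh G_def using L fc_add_smult_one[OF V, of "\<kappa>\<^sup>2" s] \<open>L = fc V s\<close>
        carrier_matD(1)[OF v(1)]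
      by (simp add: fc_def)
    moreover have nz: "(\<kappa>\<^sup>2 + s i) ^ \<alpha> \<noteq> 0" if "i < n" for i
      using s[OF that] \<kappa> by (simp add: add_nonneg_eq_0_iff)
    moreover have "precision G L \<alpha> \<kappa> = fc V (\<lambda>i. (\<kappa>\<^sup>2 + s i) ^ \<alpha>)"
      unfolding G_def \<open>L = fc V s\<close> precision_fc[OF V] ..
    moreover have "V * (\<kappa>\<^sup>2 \<cdot>\<^sub>m 1\<^sub>m n + S) ^\<^sub>m \<alpha> * adj G V = fc V (\<lambda>i. (\<kappa>\<^sup>2 + s i) ^ \<alpha>)"
      unfolding sh mat_diag_pow G_def fc_def ..
    ultimately show "(null_vectors_paired U S V \<longrightarrow>
           shifted \<kappa> L = U * (\<kappa>\<^sup>2 \<cdot>\<^sub>m 1\<^sub>m n + S) * adj G V) \<and>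
        invertible_mat (precision G L \<alpha> \<kappa>) \<and>
        minv (covariance G L \<alpha> \<kappa>) = V * (\<kappa>\<^sup>2 \<cdot>\<^sub>m 1\<^sub>m n + S) ^\<^sub>m \<alpha> * adj G V"
      using invertible_fc[OF V nz] minv_fc[OF V nz] minv_fc[OF V, of "\<lambda>i. 1 / (\<kappa>\<^sup>2 + s i) ^ \<alpha>"]
      unfolding covariance_def by simp
  qed
  show ?proj
  proof (intro allI impI, elim conjE)
    fix k \<alpha> \<alpha>' :: nat and \<kappa> \<kappa>' :: real
    assume a: "1 \<le> \<alpha>" "1 \<le> \<alpha>'" "\<kappa> \<noteq> 0" "\<kappa>' \<noteq> 0"
    have p: "0 < c\<^sup>2 + t i" if "i < n" "c \<noteq> 0" for c i
      using t[OF that(1)] that(2) by (simp add: add_pos_nonneg)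
    have cov: "covariance G L b c = fc W (\<lambda>i. 1 / (c\<^sup>2 + t i) ^ b)" if "c \<noteq> 0" for b c
      unfolding covariance_def G_def LW precision_fc[OF W] using p that
      by (intro minv_fc[OF W]) (simp add: less_imp_neq[THEN not_sym])
    \<comment> \<open>The exponent must be at least one: at exponent zero every value is 1 and all
      eigenspaces merge into one.\<close>
    have inj: "1 / (c\<^sup>2 + t i) ^ b = 1 / (c\<^sup>2 + t j) ^ b \<longleftrightarrow> t i = t j"
      if "i < n" "j < n" "c \<noteq> 0" "1 \<le> b" for i j b c
      using p[OF that(1,3)] p[OF that(2,3)] that(4) by (simp add: power_eq_iff_eq_base)
    show "eigenprojections G (covariance G L \<alpha> \<kappa>) k = eigenprojections G (covariance G L \<alpha>' \<kappa>') k"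
      unfolding cov[OF a(3)] cov[OF a(4)] unfolding G_def
    proof (rule eigenprojections_fc_cong[OF W])
      fix i j assume "i < n" "j < n"
      then show "1 / (\<kappa>\<^sup>2 + t i) ^ \<alpha> = 1 / (\<kappa>\<^sup>2 + t j) ^ \<alpha> \<longleftrightarrow>
          1 / (\<kappa>'\<^sup>2 + t i) ^ \<alpha>' = 1 / (\<kappa>'\<^sup>2 + t j) ^ \<alpha>'"
        using inj a by blast
    qed
  qed
qed

end

section \<open>Positive volumes of simplices and of dual cells\<close>

lemma triangulationD:
  assumes "triangulation M"
  shows "1 \<le> mdim M" "finite (simplices M)"
    and "\<And>s. s \<in> simplices M \<Longrightarrow> finite s \<and> s \<noteq> {}"
    and "\<And>s t. s \<in> simplices M \<Longrightarrow> t \<subseteq> s \<Longrightarrow> t \<noteq> {} \<Longrightarrow> t \<in> simplices M"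
    and "\<And>s. s \<in> simplices M \<Longrightarrow> \<exists>t \<in> ksimplices M (mdim M). s \<subseteq> t"
    and "\<And>s. s \<in> simplices M \<Longrightarrow> inj_on (chart M s) s \<and> \<not> affine_dependent (chart M s ` s)"
    and "\<And>k. bij_betw (numbering M k) {..<ncells M k} (ksimplices M k)"
proof -
  note T1 = assms[unfolded triangulation_def]
  note T2 = conjunct2[OF T1] note T3 = conjunct2[OF T2] note T4 = conjunct2[OF T3]
  note T5 = conjunct2[OF T4] note T6 = conjunct2[OF T5] note T7 = conjunct2[OF T6]
  note T8 = conjunct2[OF T7] note T9 = conjunct2[OF T8] note T10 = conjunct2[OF T9]
  note faces = bspec[OF conjunct1[OF T4]]
  show "1 \<le> mdim M" by (rule conjunct1[OF T1])
  show "finite (simplices M)" by (rule conjunct1[OF T2])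
  show "finite s \<and> s \<noteq> {}" if "s \<in> simplices M" for s using faces[OF that] by simp
  show "t \<in> simplices M" if "s \<in> simplices M" "t \<subseteq> s" "t \<noteq> {}" for s t
    using faces[OF that(1)] that(2,3) by simp
  show "\<exists>t \<in> ksimplices M (mdim M). s \<subseteq> t" if "s \<in> simplices M" for s
    by (rule bspec[OF conjunct1[OF T5] that])
  show "inj_on (chart M s) s \<and> \<not> affine_dependent (chart M s ` s)" if "s \<in> simplices M" for s
    by (rule bspec[OF conjunct1[OF T8] that])
  show "bij_betw (numbering M k) {..<ncells M k} (ksimplices M k)" for k
    by (rule spec[OF conjunct1[OF T10]])
qed

lemma simplex_volume_nonneg: "0 \<le> simplex_volume ps"
  by (induction ps rule: simplex_volume.induct) (auto simp: infdist_nonneg)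

text \<open>An affine hull is closed, so a point outside it has positive distance, and this distance
  is the height. An empty \<open>ps\<close> is harmless since a point has volume 1.\<close>

lemma simplex_volume_Cons_pos:
  assumes "p \<notin> affine hull set ps" "0 < simplex_volume ps"
  shows "0 < simplex_volume (p # ps)"
proof (cases ps)
  case (Cons q qs)
  have "affine hull set ps \<noteq> {}" using Cons by simp
  then have "infdist p (affine hull set ps) \<noteq> 0"
    using assms(1) by (simp add: in_closed_iff_infdist_zero[OF closed_affine_hull, symmetric])
  then have "0 < infdist p (affine hull set ps)" using infdist_nonneg[of p] by (simp add: less_le)
  then show ?thesis using assms(2) Cons by simp
qed simp

lemma simplex_volume_pos:
  "distinct ps \<Longrightarrow> \<not> affine_dependent (set ps) \<Longrightarrow> 0 < simplex_volume ps"
proof (induction ps)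
  case (Cons p ps)
  have "p \<notin> affine hull (set (p # ps) - {p})"
    using Cons.prems(2) unfolding affine_dependent_def by auto
  moreover have "set (p # ps) - {p} = set ps" using Cons.prems(1) by auto
  moreover have "\<not> affine_dependent (set ps)"
    using Cons.prems(2) affine_dependent_subset by (metis set_subset_Cons)
  ultimately show ?case using Cons.IH Cons.prems(1) by (intro simplex_volume_Cons_pos) auto
qed simp

lemma volume_pos:
  assumes "triangulation M" "s \<in> simplices M"
  shows "0 < volume M s"
  unfolding volume_def
  using triangulationD(3,6)[OF assms] by (intro simplex_volume_pos) (auto simp: distinct_map)

text \<open>Strict inclusion is transitive, so it passes from neighbours to all pairs. Distinctness
  bounds the length of a flag by the number of simplices.\<close>

lemma flags_distinct:
  assumes "successively (\<lambda>u t. t \<subset> u \<and> card u = Suc (card t)) F"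
  shows "distinct F"
  using assms
proof (induction F)
  case (Cons a F)
  have "sorted_wrt (\<lambda>u t. t \<subset> u) (a # F)"
    using Cons.prems
    by (intro successively_iff_sorted_wrt_strong[THEN iffD1] successively_mono[OF Cons.prems]) auto
  then have "\<forall>x\<in>set F. x \<subset> a" by simp
  then show ?case using Cons by (auto simp: successively_Cons)
qed simp

text \<open>Finiteness is essential for \<open>dual_volume\<close>: a \<open>sum\<close> over an
  infinite set is 0 by convention, which would defeat positivity.\<close>

lemma finite_flags:
  assumes "finite (simplices M)"
  shows "finite (flags M s)"
proof (rule finite_subset)
  show "flags M s \<subseteq> {F. set F \<subseteq> simplices M \<and> length F \<le> card (simplices M)}"
  proof
    fix F assume "F \<in> flags M s"
    then have F: "set F \<subseteq> simplices M" "distinct F"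
      unfolding flags_def by (simp_all add: flags_distinct)
    then have "length F \<le> card (simplices M)"
      using card_mono[OF assms F(1)] distinct_card[OF F(2)] by simp
    then show "F \<in> {F. set F \<subseteq> simplices M \<and> length F \<le> card (simplices M)}" using F(1) by simp
  qed
  show "finite {F. set F \<subseteq> simplices M \<and> length F \<le> card (simplices M)}"
    by (rule finite_lists_length_le[OF assms])
qed

text \<open>Deleting the vertices of \<open>t - s\<close> one at a time gives such a chain; with
  \<open>t\<close> of top dimension it provides a term of the sum defining
  \<open>dual_volume\<close>.\<close>

lemma descending_flag_exists:
  assumes "finite t" "s \<subseteq> t" "s \<noteq> {}"
  shows "\<exists>F. F \<noteq> [] \<and> hd F = t \<and> last F = s \<and> (\<forall>u \<in> set F. u \<subseteq> t \<and> u \<noteq> {}) \<and>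
    successively (\<lambda>u t. t \<subset> u \<and> card u = Suc (card t)) F"
  using assms
proof (induction "card (t - s)" arbitrary: t)
  case 0
  then have "t = s" by auto
  then show ?case using 0 by (intro exI[of _ "[s]"]) auto
next
  case (Suc k)
  then obtain x where x: "x \<in> t - s" by (metis card.empty equals0I nat.distinct(1))
  have eq: "t - {x} - s = (t - s) - {x}" by auto
  have "k = card (t - {x} - s)" unfolding eq using x Suc.hyps(2) Suc.prems(1) by simp
  from Suc.hyps(1)[OF this] obtain F where F: "F \<noteq> []" "hd F = t - {x}" "last F = s"
     "\<forall>u \<in> set F. u \<subseteq> t - {x} \<and> u \<noteq> {}" "successively (\<lambda>u t. t \<subset> u \<and> card u = Suc (card t)) F"
    using Suc.prems x by auto
  have "card t = Suc (card (t - {x}))" using x Suc.prems(1) by (metis DiffE card.remove)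
  moreover have "t - {x} \<subset> t" using x by auto
  ultimately show ?case
    using F Suc.prems by (intro exI[of _ "t # F"]) (auto simp: successively_Cons)
qed

text \<open>Barycentric coordinates over an affinely independent set are unique. Those of a relative
  interior point are all positive, those of a point in the affine hull of \<open>T\<close> vanish
  outside \<open>T\<close>.\<close>

lemma rel_interior_notin_affine_hull_face:
  fixes S :: "'a::euclidean_space set"
  assumes S: "\<not> affine_dependent S" and T: "T \<subset> S" and c: "c \<in> rel_interior (convex hull S)"
  shows "c \<notin> affine hull T"
proof
  assume cT: "c \<in> affine hull T"
  have fin: "finite S" using S aff_independent_finite by blast
  obtain u where u: "\<forall>x\<in>S. 0 < u x" "sum u S = 1" "(\<Sum>x\<in>S. u x *\<^sub>R x) = c"
    using c unfolding rel_interior_convex_hull_explicit[OF S] by auto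
  have finT: "finite T" using fin T finite_subset by auto
  obtain w where w: "sum w T = 1" "(\<Sum>x\<in>T. w x *\<^sub>R x) = c"
    using cT unfolding affine_hull_finite[OF finT] by auto
  \<comment> \<open>The difference of the two coordinate systems: its sum and its weighted sum
    vanish, yet it is positive at any vertex outside \<open>T\<close>, which is an affine
    dependence.\<close>
  define z where "z x = u x - (if x \<in> T then w x else 0)" for x
  have ST: "S \<inter> T = T" using T by auto
  have "sum z S = 0" using u(2) w(1) fin ST
    by (simp add: z_def sum_subtractf flip: sum.inter_restrict)
  moreover have "(\<Sum>x\<in>S. z x *\<^sub>R x) = 0"
  proof -
    have "(\<Sum>x\<in>S. z x *\<^sub>R x) = (\<Sum>x\<in>S. u x *\<^sub>R x) - (\<Sum>x\<in>S. if x \<in> T then w x *\<^sub>R x else 0)"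
      unfolding sum_subtractf[symmetric] by (intro sum.cong) (auto simp: z_def algebra_simps)
    then show ?thesis using u(3) w(2) fin ST by (simp flip: sum.inter_restrict)
  qed
  moreover obtain x where "x \<in> S" "x \<notin> T" using T by auto
  moreover from this have "z x \<noteq> 0" using u(1) by (force simp: z_def)
  ultimately show False using S affine_dependent_explicit_finite[OF fin] by blast
qed

lemma rel_interior_in_affine_hull: "c \<in> rel_interior (convex hull S) \<Longrightarrow> c \<in> affine hull S"
  using rel_interior_subset convex_hull_subset_affine_hull by blast

text \<open>The members of the tail \<open>F\<close> are subsets of \<open>hd F\<close>, so their
  centers lie in the affine hull of that proper face of \<open>u\<close>. The center of
  \<open>u\<close> lies off this hull and adds a positive height to the simplex spanned by the
  tail.\<close>

lemma circumcenters_simplex_volume_pos: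
  assumes "inj_on f t" "\<not> affine_dependent (f ` t)"
    and "\<And>u. u \<subseteq> t \<Longrightarrow> u \<noteq> {} \<Longrightarrow> c u \<in> rel_interior (convex hull (f ` u))"
    and "successively (\<lambda>u v. v \<subset> u \<and> card u = Suc (card v)) F" "\<forall>u \<in> set F. u \<subseteq> t \<and> u \<noteq> {}"
  shows "0 < simplex_volume (map c F)"
  using assms(4,5)
proof (induction F)
  case (Cons u F)
  show ?case
  proof (cases "F = []")
    case False
    have "sorted_wrt (\<lambda>u v. v \<subset> u) (u # F)"
      using Cons.prems(1)
      by (intro successively_iff_sorted_wrt_strong[THEN iffD1] successively_mono[OF Cons.prems(1)]) auto
    then have "\<forall>x\<in>set (tl F). x \<subset> hd F" using False by (cases F) auto
    then have le: "v \<subseteq> hd F" if "v \<in> set F" for v using that False by (cases F) auto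
    have hd: "hd F \<subset> u" "successively (\<lambda>u v. v \<subset> u \<and> card u = Suc (card v)) F"
      using Cons.prems(1) False by (auto simp: successively_Cons)
    have ut: "u \<subseteq> t" "u \<noteq> {}" using Cons.prems(2) by auto
    have "c v \<in> affine hull (f ` hd F)" if v: "v \<in> set F" for v
    proof -
      have "c v \<in> affine hull (f ` v)"
        using v Cons.prems(2) assms(3) by (intro rel_interior_in_affine_hull) auto
      then show ?thesis using hull_mono[OF image_mono[OF le[OF v]], of affine f] by blast
    qed
    then have "affine hull (set (map c F)) \<subseteq> affine hull (f ` hd F)"
      by (intro hull_minimal) auto
    moreover have "c u \<notin> affine hull (f ` hd F)"
    proof (rule rel_interior_notin_affine_hull_face)
      show "\<not> affine_dependent (f ` u)"
        using assms(2) ut affine_dependent_subset by (metis image_mono)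
      show "f ` hd F \<subset> f ` u"
        using hd(1) ut inj_on_image_eq_iff[OF assms(1), of "hd F" u] by (intro psubsetI) auto
      show "c u \<in> rel_interior (convex hull (f ` u))" using assms(3) ut by blast
    qed
    moreover have "0 < simplex_volume (map c F)" using Cons hd by simp
    ultimately show ?thesis by (simp only: list.map) (intro simplex_volume_Cons_pos, auto)
  qed simp
qed simp

text \<open>No term is negative, so one flag suffices, starting at a top-dimensional simplex
  \<open>t\<close> that contains \<open>s\<close>. Its circumcenters are all taken in the chart of
  \<open>t\<close>, which is why well-centeredness is stated for faces in the charts of larger
  simplices.\<close>

lemma dual_volume_pos:
  fixes M :: "('v::linorder, 'a::euclidean_space) mesh"
  assumes T: "triangulation M" and W: "well_centered M" and s: "s \<in> simplices M"
  shows "0 < dual_volume M s"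
proof -
  obtain t where t: "t \<in> ksimplices M (mdim M)" "s \<subseteq> t" using triangulationD(5)[OF T s] by blast
  then have tS: "t \<in> simplices M" by (simp add: ksimplices_def)
  note ts = triangulationD(3,6)[OF T tS]
  obtain F where F: "F \<noteq> []" "hd F = t" "last F = s" "\<forall>u \<in> set F. u \<subseteq> t \<and> u \<noteq> {}"
     "successively (\<lambda>u t. t \<subset> u \<and> card u = Suc (card t)) F"
    using descending_flag_exists[of t s] ts t(2) triangulationD(3)[OF T s] by blast
  have "set F \<subseteq> simplices M" using F(4) triangulationD(4)[OF T tS] by blast
  then have "F \<in> flags M s" using F t by (simp add: flags_def)
  moreover have "0 < simplex_volume (map (\<lambda>u. circumcenter (chart M (hd F) ` u)) F)"
    unfolding F(2)
  proof (rule circumcenters_simplex_volume_pos[OF _ _ _ F(5) F(4)])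
    show "inj_on (chart M t) t" "\<not> affine_dependent (chart M t ` t)" using ts by auto
    show "circumcenter (chart M t ` u) \<in> rel_interior (convex hull (chart M t ` u))"
      if "u \<subseteq> t" "u \<noteq> {}" for u
      using W tS that triangulationD(4)[OF T tS that] by (simp add: well_centered_def)
  qed
  ultimately show ?thesis
    unfolding dual_volume_def using finite_flags[OF triangulationD(2)[OF T]]
    by (intro sum_pos2) (auto intro: simplex_volume_nonneg)
qed

lemma numbering_simplex:
  assumes "triangulation M" "i < ncells M k"
  shows "numbering M k i \<in> simplices M"
  using bij_betwE[OF triangulationD(7)[OF assms(1)]] assms(2) by (auto simp: ksimplices_def)

section \<open>The DEC Laplacians as weighted graph Laplacians\<close>

lemma weighted_laplacian:
  fixes D :: "real mat" and h c :: "nat \<Rightarrow> real"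
  assumes D: "D \<in> carrier_mat m n" and h: "\<And>i. i < n \<Longrightarrow> 0 < h i" and c: "\<And>k. k < m \<Longrightarrow> 0 \<le> c k"
  defines "L \<equiv> mat_diag n (\<lambda>i. 1 / h i) * transpose_mat D * mat_diag m c * D"
  shows "L \<in> carrier_mat n n" "adj (mat_diag n h) L = L"
    and "x \<in> carrier_vec n \<Longrightarrow> 0 \<le> (\<Sum>i<n. h i * x $ i * (L *\<^sub>v x) $ i)"
proof -
  interpret diagonal_gram n h using h by unfold_locales
  have DT: "transpose_mat D \<in> carrier_mat n m" using D by simp
  show L: "L \<in> carrier_mat n n"
    unfolding L_def
    by (rule mult_carrier_mat[OF mult_carrier_mat[OF mult_carrier_mat[OF mat_diag_dim DT] mat_diag_dim] D])
  have entry: "L $$ (i, j) = (\<Sum>k<m. c k * D $$ (k, i) * D $$ (k, j)) / h i" if "i < n" "j < n" for i j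
    unfolding L_def mat_diag_mult_left[OF DT] using that D
    by (subst mat_diag_mult_right[of _ n]) 
      (auto simp: scalar_prod_def atLeast0LessThan sum_divide_distrib algebra_simps intro!: sum.cong)
  show "adj (mat_diag n h) L = L"
    unfolding ad_conv[OF L] using L h
    by (intro eq_matI) (auto simp: entry less_imp_neq[THEN not_sym] mult.commute mult.left_commute)
  assume x: "x \<in> carrier_vec n"
  \<comment> \<open>The weight \<open>h i\<close> cancels the factor \<open>1 / h i\<close> of
    \<open>L\<close>. After exchanging the sums, the form is the discrete Dirichlet energy, a
    \<open>c\<close>-weighted sum of squares of the entries of \<open>D *\<^sub>v x\<close>.\<close>
  have "(\<Sum>i<n. h i * x $ i * (L *\<^sub>v x) $ i) =
      (\<Sum>i<n. \<Sum>j<n. \<Sum>k<m. x $ i * (c k * D $$ (k, i) * D $$ (k, j)) * x $ j)"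
  proof (rule sum.cong[OF refl])
    fix i assume "i \<in> {..<n}"
    then have i: "i < n" by simp
    have "(L *\<^sub>v x) $ i = (\<Sum>j<n. L $$ (i, j) * x $ j)"
      using i L x by (simp add: index_mult_mat_vec scalar_prod_def atLeast0LessThan)
    then show "h i * x $ i * (L *\<^sub>v x) $ i =
      (\<Sum>j<n. \<Sum>k<m. x $ i * (c k * D $$ (k, i) * D $$ (k, j)) * x $ j)"
      using h[OF i] i by (simp add: entry sum_distrib_left sum_distrib_right sum_divide_distrib mult.assoc)
  qed
  also have "\<dots> = (\<Sum>i<n. \<Sum>k<m. \<Sum>j<n. x $ i * (c k * D $$ (k, i) * D $$ (k, j)) * x $ j)"
    by (intro sum.cong[OF refl] sum.swap)
  also have "\<dots> = (\<Sum>k<m. \<Sum>i<n. \<Sum>j<n. x $ i * (c k * D $$ (k, i) * D $$ (k, j)) * x $ j)"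
    by (rule sum.swap)
  also have "\<dots> = (\<Sum>k<m. c k * (\<Sum>i<n. D $$ (k, i) * x $ i)\<^sup>2)"
  proof (rule sum.cong[OF refl])
    fix k
    have "c k * (\<Sum>i<n. D $$ (k, i) * x $ i)\<^sup>2 =
        c k * (\<Sum>i<n. \<Sum>j<n. (D $$ (k, i) * x $ i) * (D $$ (k, j) * x $ j))"
      by (simp only: power2_eq_square sum_product)
    then show "(\<Sum>i<n. \<Sum>j<n. x $ i * (c k * D $$ (k, i) * D $$ (k, j)) * x $ j) =
        c k * (\<Sum>i<n. D $$ (k, i) * x $ i)\<^sup>2"
      by (simp add: sum_distrib_left mult_ac)
  qed
  also have "0 \<le> \<dots>" using c by (intro sum_nonneg) auto
  finally show "0 \<le> (\<Sum>i<n. h i * x $ i * (L *\<^sub>v x) $ i)" .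
qed

text \<open>Duality reverses degrees, and the chosen orientation of dual cells turns the last dual
  coboundary into the exact transpose of the first primal one. The leading weight is written as a
  reciprocal to exhibit \<open>h\<close> as the diagonal of \<open>star M 0\<close>. Dimension at
  least one makes \<open>mdim M - (mdim M - 1)\<close> equal to 1 under truncated
  subtraction.\<close>

lemma laplacian_conv:
  assumes "1 \<le> mdim M"
  shows "laplacian M = mat_diag (ncells M 0) (\<lambda>i. 1 / (dual_volume M (numbering M 0 i) / volume M (numbering M 0 i))) *
     transpose_mat (coboundary M 0) *
     mat_diag (ncells M 1) (\<lambda>i. dual_volume M (numbering M 1 i) / volume M (numbering M 1 i)) * coboundary M 0"
proof -
  have "dual_coboundary M (mdim M - 1) = transpose_mat (coboundary M 0)"
    using assms by (intro eq_matI) (auto simp: dual_coboundary_def coboundary_def)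
  then show ?thesis by (simp add: laplacian_def dual_star_def star_def)
qed

text \<open>The mirror image, with top-dimensional simplices as dual vertices and the simplices of
  one dimension less as dual edges; here \<open>h\<close> is the diagonal of
  \<open>dual_star M 0\<close>.\<close>

lemma dual_laplacian_conv:
  fixes M :: "('v::linorder, 'a::euclidean_space) mesh"
  assumes "1 \<le> mdim M"
  defines "m \<equiv> mdim M"
  shows "dual_laplacian M = mat_diag (ncells M m) (\<lambda>i. 1 / (volume M (numbering M m i) / dual_volume M (numbering M m i))) *
     transpose_mat (dual_coboundary M 0) *
     mat_diag (ncells M (m - 1)) (\<lambda>i. volume M (numbering M (m - 1) i) / dual_volume M (numbering M (m - 1) i)) *
     dual_coboundary M 0"
proof -
  have "coboundary M (m - 1) = transpose_mat (dual_coboundary M 0)"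
    using assms by (intro eq_matI) (auto simp: dual_coboundary_def coboundary_def)
  then show ?thesis by (simp add: dual_laplacian_def dual_star_def star_def m_def)
qed

theorem weighted_laplacian_svd_calculus:
  fixes L :: "real mat"
  assumes L: "L = mat_diag n (\<lambda>i. 1 / h i) * transpose_mat D * mat_diag m c * D"
    and D: "D \<in> carrier_mat m n" and h: "\<And>i. i < n \<Longrightarrow> 0 < h i" and c: "\<And>k. k < m \<Longrightarrow> 0 \<le> c k"
    and G: "G = mat_diag n h \<or> G = 1\<^sub>m n \<and> transpose_mat L = L"
  shows "\<exists>U S V. is_svd G L U S V \<and> null_vectors_paired U S V"
    and "\<forall>U S V. is_svd G L U S V \<longrightarrow> (\<forall>\<kappa> \<alpha>. \<kappa> \<noteq> 0 \<longrightarrow>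
        (null_vectors_paired U S V \<longrightarrow>
           shifted \<kappa> L = U * (\<kappa>\<^sup>2 \<cdot>\<^sub>m 1\<^sub>m n + S) * adj G V) \<and>
        invertible_mat (precision G L \<alpha> \<kappa>) \<and>
        minv (covariance G L \<alpha> \<kappa>) = V * (\<kappa>\<^sup>2 \<cdot>\<^sub>m 1\<^sub>m n + S) ^\<^sub>m \<alpha> * adj G V)"
    and "\<forall>k \<alpha> \<alpha>' \<kappa> \<kappa>'. 1 \<le> \<alpha> \<and> 1 \<le> \<alpha>' \<and> \<kappa> \<noteq> 0 \<and> \<kappa>' \<noteq> 0 \<longrightarrow>
        eigenprojections G (covariance G L \<alpha> \<kappa>) k = eigenprojections G (covariance G L \<alpha>' \<kappa>') k"
proof -
  have wl: "L \<in> carrier_mat n n" "adj (mat_diag n h) L = L"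
    "\<And>x. x \<in> carrier_vec n \<Longrightarrow> 0 \<le> (\<Sum>i<n. h i * x $ i * (L *\<^sub>v x) $ i)"
    using weighted_laplacian[of D m n h c, folded L] D h c by blast+
  \<comment> \<open>Either choice of Gram matrix is diagonal, with weight \<open>h\<close> or
    constantly 1. In both cases the form that certifies nonnegativity keeps the weight
    \<open>h\<close>.\<close>
  obtain g where g: "\<And>i. i < n \<Longrightarrow> 0 < g i" "G = mat_diag n g" "adj G L = L"
    using G
  proof
    assume "G = mat_diag n h"
    then show ?thesis using that[of h] h wl(2) by simp
  next
    assume "G = 1\<^sub>m n \<and> transpose_mat L = L"
    then show ?thesis using that[of "\<lambda>_. 1"] adj_one[OF wl(1)] by simp
  qed
  interpret diagonal_gram n g using g(1) by unfold_locales
  note calc = nonneg_selfadjoint_svd_calculus[OF wl(1) g(3)[unfolded g(2)] h wl(3), folded g(2)]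
  show "\<exists>U S V. is_svd G L U S V \<and> null_vectors_paired U S V" by (rule calc(1))
  show "\<forall>U S V. is_svd G L U S V \<longrightarrow> (\<forall>\<kappa> \<alpha>. \<kappa> \<noteq> 0 \<longrightarrow>
        (null_vectors_paired U S V \<longrightarrow>
           shifted \<kappa> L = U * (\<kappa>\<^sup>2 \<cdot>\<^sub>m 1\<^sub>m n + S) * adj G V) \<and>
        invertible_mat (precision G L \<alpha> \<kappa>) \<and>
        minv (covariance G L \<alpha> \<kappa>) = V * (\<kappa>\<^sup>2 \<cdot>\<^sub>m 1\<^sub>m n + S) ^\<^sub>m \<alpha> * adj G V)" by (rule calc(2))
  show "\<forall>k \<alpha> \<alpha>' \<kappa> \<kappa>'. 1 \<le> \<alpha> \<and> 1 \<le> \<alpha>' \<and> \<kappa> \<noteq> 0 \<and> \<kappa>' \<noteq> 0 \<longrightarrow>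
        eigenprojections G (covariance G L \<alpha> \<kappa>) k = eigenprojections G (covariance G L \<alpha>' \<kappa>') k"
    by (rule calc(3))
qed

theorem corollary2:
  fixes M :: "('v::linorder, 'a::euclidean_space) mesh"
    and G G' :: "real mat"
  assumes "triangulation M" "well_centered M" "shape_regular M"
    and "G = star M 0 \<or>
         G = 1\<^sub>m (ncells M 0) \<and> transpose_mat (laplacian M) = laplacian M"
    and "G' = dual_star M 0 \<or>
         G' = 1\<^sub>m (ncells M (mdim M)) \<and> transpose_mat (dual_laplacian M) = dual_laplacian M"
  shows
    "(\<exists>U S V. is_svd G (laplacian M) U S V \<and> null_vectors_paired U S V) \<and>
     (\<forall>U S V. is_svd G (laplacian M) U S V \<longrightarrow> (\<forall>\<kappa> \<alpha>. \<kappa> \<noteq> 0 \<longrightarrow>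
        (null_vectors_paired U S V \<longrightarrow>
           shifted \<kappa> (laplacian M) = U * (\<kappa>\<^sup>2 \<cdot>\<^sub>m 1\<^sub>m (ncells M 0) + S) * adj G V) \<and>
        invertible_mat (precision G (laplacian M) \<alpha> \<kappa>) \<and>
        minv (covariance G (laplacian M) \<alpha> \<kappa>)
          = V * (\<kappa>\<^sup>2 \<cdot>\<^sub>m 1\<^sub>m (ncells M 0) + S) ^\<^sub>m \<alpha> * adj G V)) \<and>
     (\<forall>k \<alpha> \<alpha>' \<kappa> \<kappa>'. 1 \<le> \<alpha> \<and> 1 \<le> \<alpha>' \<and> \<kappa> \<noteq> 0 \<and> \<kappa>' \<noteq> 0 \<longrightarrow>
        eigenprojections G (covariance G (laplacian M) \<alpha> \<kappa>) k
          = eigenprojections G (covariance G (laplacian M) \<alpha>' \<kappa>') k) \<and>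

     (\<exists>U S V. is_svd G' (dual_laplacian M) U S V \<and> null_vectors_paired U S V) \<and>
     (\<forall>U S V. is_svd G' (dual_laplacian M) U S V \<longrightarrow> (\<forall>\<kappa> \<alpha>. \<kappa> \<noteq> 0 \<longrightarrow>
        (null_vectors_paired U S V \<longrightarrow>
           shifted \<kappa> (dual_laplacian M) = U * (\<kappa>\<^sup>2 \<cdot>\<^sub>m 1\<^sub>m (ncells M (mdim M)) + S) * adj G' V) \<and>
        invertible_mat (precision G' (dual_laplacian M) \<alpha> \<kappa>) \<and>
        minv (covariance G' (dual_laplacian M) \<alpha> \<kappa>)
          = V * (\<kappa>\<^sup>2 \<cdot>\<^sub>m 1\<^sub>m (ncells M (mdim M)) + S) ^\<^sub>m \<alpha> * adj G' V)) \<and>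
     (\<forall>k \<alpha> \<alpha>' \<kappa> \<kappa>'. 1 \<le> \<alpha> \<and> 1 \<le> \<alpha>' \<and> \<kappa> \<noteq> 0 \<and> \<kappa>' \<noteq> 0 \<longrightarrow>
        eigenprojections G' (covariance G' (dual_laplacian M) \<alpha> \<kappa>) k
          = eigenprojections G' (covariance G' (dual_laplacian M) \<alpha>' \<kappa>') k)"
proof -
  have m: "1 \<le> mdim M" using triangulationD(1)[OF assms(1)] .
  \<comment> \<open>Stated for every \<open>k\<close>, since the primal side uses degrees 0 and 1
    and the dual side \<open>mdim M\<close> and \<open>mdim M - 1\<close>.\<close>
  have pos: "0 < dual_volume M (numbering M k i) / volume M (numbering M k i)"
     "0 < volume M (numbering M k i) / dual_volume M (numbering M k i)" if "i < ncells M k" for k i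
    using dual_volume_pos[OF assms(1,2) numbering_simplex[OF assms(1) that]]
      volume_pos[OF assms(1) numbering_simplex[OF assms(1) that]] by simp_all
  have D: "coboundary M 0 \<in> carrier_mat (ncells M 1) (ncells M 0)"
    "dual_coboundary M 0 \<in> carrier_mat (ncells M (mdim M - 1)) (ncells M (mdim M))"
    by (simp_all add: coboundary_def dual_coboundary_def)
  \<comment> \<open>Unfolding \<open>dual_star M 0\<close> produces \<open>mdim M - 0\<close>, which
    has to be simplified before the general theorem matches.\<close>
  have G': "G' = mat_diag (ncells M (mdim M))
         (\<lambda>i. volume M (numbering M (mdim M) i) / dual_volume M (numbering M (mdim M) i)) \<or>
       G' = 1\<^sub>m (ncells M (mdim M)) \<and> transpose_mat (dual_laplacian M) = dual_laplacian M"
    using assms(5) by (simp add: dual_star_def)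
  note primal = weighted_laplacian_svd_calculus
    [OF laplacian_conv[OF m] D(1) pos(1) less_imp_le[OF pos(1)] assms(4)[unfolded star_def]]
  note dual = weighted_laplacian_svd_calculus
    [OF dual_laplacian_conv[OF m] D(2) pos(2) less_imp_le[OF pos(2)] G']
  show ?thesis
    by (intro conjI primal dual)
qed

end
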